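(* Let $m\le n$. Consider the mechanical system $$\dot q=\nabla_p H(q,p),\qquad \dot p=-\nabla_q H(q,p)+G(q)u,\qquad H(q,p)=\tfrac12 p^\top M^{-1}p+V(q),$$ with constant inertia matrix $M\succ0$ (and no disturbance), and a feasible desired trajectory $x^\star(t)=[q^\star(t)^\top,p^\star(t)^\top]^\top$, $p^\star=M\dot q^\star$. Suppose there exist a constant matrix $J_{d_{12}}\in\mathbb{R}^{n\times n}$, constant positive definite matrices $M_d\in\mathbb{R}^{n\times n}$, $M_e\in\mathbb{R}^{m\times m}$, a function $V_{d_1}:\mathbb{R}^n\times\mathbb{R}^m\times\mathbb{R}_+\to\mathbb{R}_+$, constant full-rank matrices $S_1=[s_{11},s_{12}]\in\mathbb{R}^{n\times 2m}$ (with $s_{11},s_{12}\in\mathbb{R}^{n\times m}$) and $S_2\in\mathbb{R}^{2m\times n}$, and a constant matrix $F_e=J_e-R_e\in\mathbb{R}^{2m\times 2m}$ with $J_e=-J_e^\top$, $R_e=R_e^\top\succ0$, such that, writing $x_e=[q_e^\top,p_e^\top]^\top\in\mathbb{R}^{2m}$, $\xi=[q^\top,p^\top,x_e^\top]^\top$, $$H_{d_1}(\xi,t)=\tfrac12p^\top M_d^{-1}p+\tfrac12p_e^\top M_e^{-1}p_e+V_{d_1}(q,q_e,t),\qquad P_1=\begin{bmatrix}0&J_{d_{12}}&0\\-J_{d_{12}}^\top&0&S_1\\S_2&0&F_e\end{bmatrix},$$ the following hold. (i) The matching equations $$M^{-1}p=J_{d_{12}}M_d^{-1}p,\qquad G^\perp\big(\nabla_qV-J_{d_{12}}^\top\nabla_qV_{d_1}+s_{11}\nabla_{q_e}V_{d_1}+s_{12}M_e^{-1}p_e\big)=0$$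 hold identically. (ii) $P_1$ is Hurwitz; there are constants $0<\alpha_1<\beta_1$ and an open set $D_1\subseteq\mathbb{R}^{2n+2m}$ such that $\alpha_1I\prec\nabla^2_\xi H_{d_1}(\xi,t)\prec\beta_1I$ for all $\xi\in D_1$ and all $t$; and there is $\varepsilon_1>0$ such that $$N_1=\begin{bmatrix}P_1&\big(1-\frac{\alpha_1}{\beta_1}\big)P_1P_1^\top\\-\big(1-\frac{\alpha_1}{\beta_1}+\varepsilon_1\big)I&-P_1^\top\end{bmatrix}$$ has no eigenvalues on the imaginary axis. (iii) There is $x_e^\star(t)$ such that $\xi^\star=[{x^\star}^\top,{x_e^\star}^\top]^\top$ satisfies $\dot\xi^\star=P_1\nabla_\xi H_{d_1}(\xi^\star,t)$. Then the input $$u=G^\dagger(q)\big(-J_{d_{12}}^\top\nabla_qV_{d_1}(q,q_e,t)+S_1\nabla_{x_e}H_{d_1}(\xi,t)+\nabla_qV(q)\big),$$ with $$\dot x_e=S_2\nabla_qV_{d_1}(q,q_e,t)+F_e\nabla_{x_e}H_{d_1}(\xi,t),$$ guarantees that the trajectories of the closed-loop system converge exponentially to $x^\star(t)$.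
   Context: $q,p\in\mathbb{R}^n$ are positions and momenta, $u\in\mathbb{R}^m$ the input, $V:\mathbb{R}^n\to\mathbb{R}_+$ the potential energy, $G:\mathbb{R}^n\to\mathbb{R}^{n\times m}$ with $\mathrm{rank}(G)=m\le n$. All functions are sufficiently smooth. $A\succ0$ means $A$ is (symmetric) positive definite. $\nabla$ denotes the column gradient, $\nabla^2$ the Hessian. For full-column-rank $g$, $g^\dagger=(g^\top g)^{-1}g^\top$. $G^\perp$ is a full-rank left annihilator of $G$ ($G^\perp G=0$, $G^\perp\in\mathbb{R}^{(n-m)\times n}$). A matrix is Hurwitz if all its eigenvalues have strictly negative real parts. A feasible trajectory is a function $x^\star=[{q^\star}^\top,{p^\star}^\top]^\top$ of time for which there is an input $u^\star(t)$ such that $(x^\star,u^\star)$ satisfies the system equations for all $t$ in its time domain, here $\mathbb{R}_+$. A system $\dot x=f(x,t)$ is contractive on an open set $D$ if there are a symmetric matrix function $Q(x,t)$, uniformly positive definite and bounded, and $\lambda>0$ with $\frac{\partial f}{\partial x}^\top Q+Q\frac{\partial f}{\partial x}+\dot Q\preceq-2\lambda Q$ on $D$ for all $t$. Convergence to the desired trajectory is understood in the sense of the convergence property of contractive systems (Lohmiller and Slotine): trajectories starting in a ball (with respect to the contraction metric) centered at the desired trajectory of the (extended) closed-loop system, this moving ball being contained at all times in the contraction region ($D_1$ here), remain in that ball and converge exponentially to the desired trajectory as $t\to\infty$; if the region is the whole space, all trajectories do. *)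

theory Defs
  imports "HOL-Analysis.Analysis"
begin

text \<open>Stacked vectors and block matrices are indexed by sum types, so that a vector of
  dimension $n + k$ has type \<^typ>\<open>real^('n + 'k)\<close> and $2m$ is the index type \<^typ>\<open>'m + 'm\<close>.\<close>

definition vjoin :: "'a^'m \<Rightarrow> 'a^'n \<Rightarrow> 'a^('m + 'n)" where
  "vjoin x y = (\<chi> i. case i of Inl a \<Rightarrow> x $ a | Inr b \<Rightarrow> y $ b)"

definition vfst :: "'a^('m::finite + 'n::finite) \<Rightarrow> 'a^'m" where
  "vfst z = (\<chi> i. z $ Inl i)"

definition vsnd :: "'a^('m::finite + 'n::finite) \<Rightarrow> 'a^'n" where
  "vsnd z = (\<chi> i. z $ Inr i)"

definition vcat :: "'a^'c^'m \<Rightarrow> 'a^'c^'n \<Rightarrow> 'a^'c^('m + 'n)" where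
  "vcat A B = vjoin A B"

definition hcat :: "'a^'c^'m \<Rightarrow> 'a^'d^'m \<Rightarrow> 'a^('c + 'd)^'m" where
  "hcat A B = (\<chi> i. vjoin (A $ i) (B $ i))"

definition block :: "'a^'c^'m \<Rightarrow> 'a^'d^'m \<Rightarrow> 'a^'c^'n \<Rightarrow> 'a^'d^'n \<Rightarrow> 'a^('c + 'd)^('m + 'n)" where
  "block A B C D = vcat (hcat A B) (hcat C D)"


definition posdef :: "real^'n^'n \<Rightarrow> bool" where
  "posdef A \<longleftrightarrow> transpose A = A \<and> (\<forall>x. x \<noteq> 0 \<longrightarrow> x \<bullet> (A *v x) > 0)"

definition possemidef :: "real^'n^'n \<Rightarrow> bool" where
  "possemidef A \<longleftrightarrow> transpose A = A \<and> (\<forall>x. x \<bullet> (A *v x) \<ge> 0)"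

definition full_rank :: "real^'n^'m \<Rightarrow> bool" where
  "full_rank A \<longleftrightarrow> rank A = min CARD('m) CARD('n)"

definition is_eigenvalue :: "real^'n^'n \<Rightarrow> complex \<Rightarrow> bool" where
  "is_eigenvalue A z \<longleftrightarrow> (\<exists>v. v \<noteq> 0 \<and> map_matrix complex_of_real A *v v = z *s v)"

definition hurwitz :: "real^'n^'n \<Rightarrow> bool" where
  "hurwitz A \<longleftrightarrow> (\<forall>z. is_eigenvalue A z \<longrightarrow> Re z < 0)"

definition left_pinv :: "real^'m^'n \<Rightarrow> real^'n^'m" where
  "left_pinv g = matrix_inv (transpose g ** g) ** transpose g"

text \<open>A full-rank left annihilator of an $n \times m$ matrix has $n - m$ rows, which may be
  none at all and hence cannot be indexed by a type.  It is given by its rows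
  \<^term>\<open>W i\<close> for \<^term>\<open>i < CARD('n) - CARD('m)\<close>; other values of \<^term>\<open>W\<close> are irrelevant.\<close>

definition left_annihilator :: "(nat \<Rightarrow> real^'n) \<Rightarrow> real^'m^'n \<Rightarrow> bool" where
  "left_annihilator W g \<longleftrightarrow>
     (\<forall>i < CARD('n) - CARD('m). W i v* g = 0) \<and>
     inj_on W {..<CARD('n) - CARD('m)} \<and> independent (W ` {..<CARD('n) - CARD('m)})"


definition grad :: "(real^'n \<Rightarrow> real) \<Rightarrow> real^'n \<Rightarrow> real^'n" where
  "grad f x = (\<chi> i. frechet_derivative f (at x) (axis i 1))"

definition hess :: "(real^'n \<Rightarrow> real) \<Rightarrow> real^'n \<Rightarrow> real^'n^'n" where
  "hess f x = jacobian (grad f) (at x)"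

definition C1_deriv_on ::
  "'a::real_normed_vector set \<Rightarrow> ('a \<Rightarrow> 'b::real_normed_vector) \<Rightarrow> ('a \<Rightarrow> ('a \<Rightarrow>\<^sub>L 'b)) \<Rightarrow> bool" where
  "C1_deriv_on S f f' \<longleftrightarrow> continuous_on S f' \<and>
     (\<forall>x\<in>S. (f has_derivative blinfun_apply (f' x)) (at x within S))"

text \<open>Twice continuously differentiable in the vector argument, with value, gradient and Hessian
  jointly continuous in the vector argument and the time \<^term>\<open>t \<ge> 0\<close>.\<close>

definition C2_timed :: "(real^'n \<Rightarrow> real \<Rightarrow> real) \<Rightarrow> bool" where
  "C2_timed f \<longleftrightarrow>
     (\<forall>t\<ge>0. \<forall>x. (\<lambda>x. f x t) differentiable (at x) \<and> grad (\<lambda>x. f x t) differentiable (at x)) \<and>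
     continuous_on (UNIV \<times> {0..}) (\<lambda>(x, t). f x t) \<and>
     continuous_on (UNIV \<times> {0..}) (\<lambda>(x, t). grad (\<lambda>x. f x t) x) \<and>
     continuous_on (UNIV \<times> {0..}) (\<lambda>(x, t). hess (\<lambda>x. f x t) x)"


definition mech_H :: "real^'n^'n \<Rightarrow> (real^'n \<Rightarrow> real) \<Rightarrow> real^'n \<Rightarrow> real^'n \<Rightarrow> real" where
  "mech_H M V q p = 1/2 * (p \<bullet> (matrix_inv M *v p)) + V q"

definition mech_qdot :: "real^'n^'n \<Rightarrow> (real^'n \<Rightarrow> real) \<Rightarrow> real^'n \<Rightarrow> real^'n \<Rightarrow> real^'n" where
  "mech_qdot M V q p = grad (\<lambda>p. mech_H M V q p) p"

definition mech_pdot ::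
  "real^'n^'n \<Rightarrow> (real^'n \<Rightarrow> real) \<Rightarrow> (real^'n \<Rightarrow> real^'m^'n) \<Rightarrow>
   real^'n \<Rightarrow> real^'n \<Rightarrow> real^'m \<Rightarrow> real^'n" where
  "mech_pdot M V G q p u = - grad (\<lambda>q. mech_H M V q p) q + G q *v u"

definition feasible_traj ::
  "real^'n^'n \<Rightarrow> (real^'n \<Rightarrow> real) \<Rightarrow> (real^'n \<Rightarrow> real^'m^'n) \<Rightarrow>
   (real \<Rightarrow> real^'n) \<Rightarrow> (real \<Rightarrow> real^'n) \<Rightarrow> bool" where
  "feasible_traj M V G q p \<longleftrightarrow> (\<exists>u. \<forall>t\<ge>0.
     (q has_vector_derivative mech_qdot M V (q t) (p t)) (at t within {0..}) \<and>
     (p has_vector_derivative mech_pdot M V G (q t) (p t) (u t)) (at t within {0..}))"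


text \<open>The extended state is $\xi = [q; [p; x_e]]$ with $x_e = [q_e; p_e]$.\<close>

definition q_of :: "'a^('n::finite + 'n + 'm::finite + 'm) \<Rightarrow> 'a^'n" where
  "q_of \<xi> = vfst \<xi>"

definition p_of :: "'a^('n::finite + 'n + 'm::finite + 'm) \<Rightarrow> 'a^'n" where
  "p_of \<xi> = vfst (vsnd \<xi>)"

definition xe_of :: "'a^('n::finite + 'n + 'm::finite + 'm) \<Rightarrow> 'a^('m + 'm)" where
  "xe_of \<xi> = vsnd (vsnd \<xi>)"

definition Hd ::
  "real^'n^'n \<Rightarrow> real^'m^'m \<Rightarrow> (real^'n \<Rightarrow> real^'m \<Rightarrow> real \<Rightarrow> real) \<Rightarrow>
   real^('n + 'n + 'm + 'm) \<Rightarrow> real \<Rightarrow> real" where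
  "Hd Md Me Vd \<xi> t =
     (let q = q_of \<xi>; p = p_of \<xi>; qe = vfst (xe_of \<xi>); pe = vsnd (xe_of \<xi>)
      in 1/2 * (p \<bullet> (matrix_inv Md *v p)) + 1/2 * (pe \<bullet> (matrix_inv Me *v pe)) + Vd q qe t)"

definition grad_q_Vd ::
  "(real^'n \<Rightarrow> real^'m \<Rightarrow> real \<Rightarrow> real) \<Rightarrow> real^'n \<Rightarrow> real^'m \<Rightarrow> real \<Rightarrow> real^'n" where
  "grad_q_Vd Vd q qe t = grad (\<lambda>q. Vd q qe t) q"

definition grad_qe_Vd ::
  "(real^'n \<Rightarrow> real^'m \<Rightarrow> real \<Rightarrow> real) \<Rightarrow> real^'n \<Rightarrow> real^'m \<Rightarrow> real \<Rightarrow> real^'m" where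
  "grad_qe_Vd Vd q qe t = grad (\<lambda>qe. Vd q qe t) qe"

definition grad_xe_Hd ::
  "real^'n^'n \<Rightarrow> real^'m^'m \<Rightarrow> (real^'n \<Rightarrow> real^'m \<Rightarrow> real \<Rightarrow> real) \<Rightarrow>
   real^('n + 'n + 'm + 'm) \<Rightarrow> real \<Rightarrow> real^('m + 'm)" where
  "grad_xe_Hd Md Me Vd \<xi> t =
     grad (\<lambda>xe. Hd Md Me Vd (vjoin (q_of \<xi>) (vjoin (p_of \<xi>) xe)) t) (xe_of \<xi>)"

definition P_mat ::
  "real^'n^'n \<Rightarrow> real^('m::finite + 'm)^'n \<Rightarrow> real^'n^('m + 'm) \<Rightarrow> real^('m + 'm)^('m + 'm) \<Rightarrow>
   real^('n + 'n + 'm + 'm)^('n + 'n + 'm + 'm)" where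
  "P_mat J S1 S2 Fe =
     block 0                          (hcat J 0)
           (vcat (- transpose J) S2)  (block 0 S1
                                             0 Fe)"

definition N_mat :: "real^'k^'k \<Rightarrow> real \<Rightarrow> real \<Rightarrow> real \<Rightarrow> real^('k + 'k)^('k + 'k)" where
  "N_mat P \<alpha> \<beta> \<epsilon> =
     block P                             ((1 - \<alpha> / \<beta>) *\<^sub>R (P ** transpose P))
           (- mat (1 - \<alpha> / \<beta> + \<epsilon>))  (- transpose P)"

definition control ::
  "(real^'n \<Rightarrow> real) \<Rightarrow> (real^'n \<Rightarrow> real^'m^'n) \<Rightarrow> real^'n^'n \<Rightarrow> real^'n^'n \<Rightarrow> real^'m^'m \<Rightarrow>
   (real^'n \<Rightarrow> real^'m \<Rightarrow> real \<Rightarrow> real) \<Rightarrow> real^('m + 'm)^'n \<Rightarrow>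
   real^('n + 'n + 'm + 'm) \<Rightarrow> real \<Rightarrow> real^'m" where
  "control V G J Md Me Vd S1 \<xi> t =
     left_pinv (G (q_of \<xi>)) *v
       (- (transpose J *v grad_q_Vd Vd (q_of \<xi>) (vfst (xe_of \<xi>)) t)
        + S1 *v grad_xe_Hd Md Me Vd \<xi> t + grad V (q_of \<xi>))"

definition closed_loop ::
  "real^'n^'n \<Rightarrow> (real^'n \<Rightarrow> real) \<Rightarrow> (real^'n \<Rightarrow> real^'m^'n) \<Rightarrow> real^'n^'n \<Rightarrow> real^'n^'n \<Rightarrow>
   real^'m^'m \<Rightarrow> (real^'n \<Rightarrow> real^'m \<Rightarrow> real \<Rightarrow> real) \<Rightarrow> real^('m + 'm)^'n \<Rightarrow>
   real^'n^('m + 'm) \<Rightarrow> real^('m + 'm)^('m + 'm) \<Rightarrow>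
   real^('n + 'n + 'm + 'm) \<Rightarrow> real \<Rightarrow> real^('n + 'n + 'm + 'm)" where
  "closed_loop M V G J Md Me Vd S1 S2 Fe \<xi> t =
     vjoin (mech_qdot M V (q_of \<xi>) (p_of \<xi>))
       (vjoin (mech_pdot M V G (q_of \<xi>) (p_of \<xi>) (control V G J Md Me Vd S1 \<xi> t))
         (S2 *v grad_q_Vd Vd (q_of \<xi>) (vfst (xe_of \<xi>)) t + Fe *v grad_xe_Hd Md Me Vd \<xi> t))"


text \<open>Contraction of $\dot x = f(x,t)$, $t \ge 0$, on \<^term>\<open>D\<close>.  The metric \<^term>\<open>Q\<close> lives on
  the whole state space, so that lengths of arbitrary curves are meaningful; the contraction
  inequality is required on \<^term>\<open>D\<close> only.  The term \<^term>\<open>Q' (x, t) (f x t, 1)\<close> is the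
  derivative of \<^term>\<open>Q\<close> along the flow, $\partial_t Q + \sum_i f_i\, \partial_{x_i} Q$.\<close>

definition contraction_metric ::
  "(real^'k \<Rightarrow> real \<Rightarrow> real^'k) \<Rightarrow> (real^'k) set \<Rightarrow> (real^'k \<Rightarrow> real \<Rightarrow> real^'k^'k) \<Rightarrow> real \<Rightarrow> bool" where
  "contraction_metric f D Q l \<longleftrightarrow> l > 0 \<and>
     (\<exists>a b. 0 < a \<and> 0 < b \<and>
        (\<forall>x. \<forall>t\<ge>0. possemidef (Q x t - mat a) \<and> possemidef (mat b - Q x t))) \<and>
     (\<forall>x\<in>D. \<forall>t\<ge>0. (\<lambda>x. f x t) differentiable (at x)) \<and>
     (\<exists>Q'. C1_deriv_on (UNIV \<times> {0..}) (\<lambda>(x, t). Q x t) Q' \<and>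
        (\<forall>x\<in>D. \<forall>t\<ge>0. let F = jacobian (\<lambda>x. f x t) (at x) in
           possemidef (- ((2 * l) *\<^sub>R Q x t)
             - (transpose F ** Q x t + Q x t ** F + blinfun_apply (Q' (x, t)) (f x t, 1)))))"

definition riem_dist :: "(real^'k \<Rightarrow> real \<Rightarrow> real^'k^'k) \<Rightarrow> real \<Rightarrow> real^'k \<Rightarrow> real^'k \<Rightarrow> real" where
  "riem_dist Q t x y = Inf {L. \<exists>c c'. c 0 = x \<and> c 1 = y \<and> continuous_on {0..1} c' \<and>
     (\<forall>s\<in>{0..1}. (c has_vector_derivative c' s) (at s within {0..1})) \<and>
     ((\<lambda>s. sqrt (c' s \<bullet> (Q (c s) t *v c' s))) has_integral L) {0..1}}"

definition riem_ball :: "(real^'k \<Rightarrow> real \<Rightarrow> real^'k^'k) \<Rightarrow> real \<Rightarrow> real^'k \<Rightarrow> real \<Rightarrow> (real^'k) set" where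
  "riem_ball Q t x r = {y. riem_dist Q t x y < r}"

definition trajectory_on ::
  "real set \<Rightarrow> (real^'k \<Rightarrow> real \<Rightarrow> real^'k) \<Rightarrow> (real \<Rightarrow> real^'k) \<Rightarrow> bool" where
  "trajectory_on I f x \<longleftrightarrow> (\<forall>t\<in>I. (x has_vector_derivative f (x t) t) (at t within I))"

text \<open>The convergence property of contractive systems.  Admitting every time interval
  \<^term>\<open>I\<close> that starts at 0 covers trajectories on the half-line, and bounds trajectories
  independently of whether they are known to exist for all times.  If \<^term>\<open>D = UNIV\<close>, the ball
  condition holds for all radii, so every trajectory is covered.\<close>

definition contraction_converges ::
  "(real^'k \<Rightarrow> real \<Rightarrow> real^'k) \<Rightarrow> (real^'k) set \<Rightarrow> (real \<Rightarrow> real^'k) \<Rightarrow> bool" where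
  "contraction_converges f D xd \<longleftrightarrow>
     (\<exists>Q l C \<mu>. contraction_metric f D Q l \<and> C > 0 \<and> \<mu> > 0 \<and>
        (\<forall>r>0. (\<forall>t\<ge>0. riem_ball Q t (xd t) r \<subseteq> D) \<longrightarrow>
           (\<forall>I x. is_interval I \<and> 0 \<in> I \<and> I \<subseteq> {0..} \<and> trajectory_on I f x \<and>
                  x 0 \<in> riem_ball Q 0 (xd 0) r \<longrightarrow>
              (\<forall>t\<in>I. x t \<in> riem_ball Q t (xd t) r \<and>
                     norm (x t - xd t) \<le> C * exp (- \<mu> * t) * norm (x 0 - xd 0)))))"

end

theory Submission
  imports Defs
begin

text \<open>By the matching equations the closed loop is \<open>\<xi>' = P \<nabla>H(\<xi>, t)\<close>, with Jacobian \<open>P S\<close> where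
  \<open>\<alpha> I < S < \<beta> I\<close> on \<open>D\<close>.  Put \<open>c = 1 - \<alpha>/\<beta>\<close> and \<open>w = S x / \<beta>\<close>; then \<open>\<bar>w - x\<bar> \<le> c \<bar>x\<bar>\<close>, so a constant
  contraction metric \<open>X\<close> is obtained from a solution of the linear matrix inequality
  \<open>(P w) \<cdot> X x + s (c\<^sup>2 \<bar>x\<bar>\<^sup>2 - \<bar>w - x\<bar>\<^sup>2) < 0\<close> for \<open>(x, w) \<noteq> 0\<close>.  By Rantzer's proof of the
  Kalman--Yakubovich--Popov lemma (convex separation, and spectral decomposition of a skew
  operator on the dual side) it is solvable if the form is negative whenever
  \<open>i \<omega> x = P w\<close>.  That frequency condition holds for large \<open>\<omega>\<close>, and at the largest \<open>\<omega>\<close> where it failed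
  \<open>N\<close> would have the eigenvalue \<open>i \<omega>\<close>.  Positivity of \<open>X\<close> follows from \<open>P\<close> being Hurwitz by
  continuation along \<open>P - s I\<close>, \<open>s \<ge> 0\<close>.  In the constant metric the balls are ellipsoids, hence
  convex, and the mean value theorem along segments gives exponential decay.\<close>

section \<open>Block matrices and quadratic forms\<close>

text \<open>The obstacle is that the Hessian \<open>S\<close> varies with state and time and only
  its spectral bounds are known, so one \<open>X\<close> has to serve a whole family of Jacobians.
  The bound on \<open>w - x\<close> is quadratic in \<open>(x, w)\<close>; adding it with a
  multiplier \<open>s \<ge> 0\<close> removes \<open>S\<close> from the inequality. With
  \<open>R\<close> the inverse of \<open>P\<close>, the frequency condition asks for
  \<open>|i \<omega> R x - x|^2 > c^2 |x|^2\<close>, and \<open>N\<close> detects where the stronger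
  form with \<open>c (c + \<epsilon>)\<close> in place of \<open>c^2\<close> degenerates. In the
  duality step, insolubility yields weights \<open>c_b\<close> and vectors \<open>z_b\<close> for
  which the sum of the matrices \<open>c_b A z_b (B z_b)^T\<close> is skew. With the vectors
  \<open>sqrt c_b z_b\<close> as columns of \<open>Z\<close>, this sum is
  \<open>A Z (B Z)^T\<close>; so off the kernel of \<open>B Z\<close> one has
  \<open>A Z = B Z \<Omega>\<close> with \<open>\<Omega>\<close> skew, and each invariant plane of
  \<open>\<Omega>\<close> gives a complex vector to which the frequency condition applies.
  Negativity on all planes makes a trace negative that the failed separation makes
  nonnegative.\<close>

lemma vjoin_nth [simp]: "vjoin x y $ Inl i = x $ i" "vjoin x y $ Inr j = y $ j"
  by (simp_all add: vjoin_def)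

lemma vfst_vjoin [simp]: "vfst (vjoin x y) = x" and vsnd_vjoin [simp]: "vsnd (vjoin x y) = y"
  by (simp_all add: vfst_def vsnd_def vec_eq_iff)

lemma vjoin_vfst_vsnd [simp]: "vjoin (vfst z) (vsnd z) = z"
  by (simp add: vjoin_def vfst_def vsnd_def vec_eq_iff split: sum.split)

lemma vjoin_add: "vjoin x y + vjoin x' y' = vjoin (x + x') (y + y')"
  by (simp add: vjoin_def vec_eq_iff split: sum.split)

lemma vjoin_uminus: "- vjoin x y = vjoin (- x) (- y)" for x :: "'a::ab_group_add^'m"
  by (simp add: vjoin_def vec_eq_iff split: sum.split)

lemma vjoin_0 [simp]: "vjoin 0 0 = 0"
  by (simp add: vjoin_def vec_eq_iff split: sum.split)

lemma vjoin_scaleR: "c *\<^sub>R vjoin x y = vjoin (c *\<^sub>R x) (c *\<^sub>R y)"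
  by (simp add: vjoin_def vec_eq_iff split: sum.split)

lemma sum_UNIV_Plus:
  fixes g :: "'a::finite + 'b::finite \<Rightarrow> 'c::comm_monoid_add"
  shows "sum g UNIV = (\<Sum>i\<in>UNIV. g (Inl i)) + (\<Sum>j\<in>UNIV. g (Inr j))"
  by (simp add: sum.Plus o_def flip: UNIV_Plus_UNIV)

lemma inner_vjoin: "vjoin x y \<bullet> vjoin x' y' = x \<bullet> x' + y \<bullet> y'"
  by (simp add: inner_vec_def sum_UNIV_Plus)

lemma hcat_vjoin: "hcat A B *v vjoin x y = A *v x + B *v y"
  by (simp add: hcat_def matrix_vector_mult_def sum_UNIV_Plus vec_eq_iff)

lemma vcat_mult: "vcat A B *v x = vjoin (A *v x) (B *v x)"
  by (simp add: vcat_def matrix_vector_mult_def vjoin_def vec_eq_iff split: sum.split)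

lemma block_vjoin: "block A B C D *v vjoin x y = vjoin (A *v x + B *v y) (C *v x + D *v y)"
  by (simp add: block_def vcat_mult hcat_vjoin)

lemma uminus_mv: "(- A) *v x = - (A *v x)" for A :: "'a::ring_1^'n^'m"
  by (simp add: matrix_vector_mult_def vec_eq_iff sum_negf)

lemma scaleR_mv: "(c *\<^sub>R A) *v x = c *\<^sub>R (A *v x)" for A :: "real^'n^'m"
  by (simp add: matrix_vector_mult_def vec_eq_iff sum_distrib_left mult_ac)

lemma mat_mv: "mat c *v x = c *\<^sub>R x" for x :: "real^'n"
  by (simp add: matrix_vector_mult_def mat_def vec_eq_iff if_distrib[of "\<lambda>y. y * _"] cong: if_cong)

lemma inner_mv_symmetric:
  fixes X :: "real^'n^'n"
  assumes "transpose X = X"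
  shows "x \<bullet> (X *v y) = y \<bullet> (X *v x)"
  by (metis assms dot_lmul_matrix inner_commute transpose_matrix_vector)

lemma bilinear_inner_mv: "bilinear (\<lambda>x y. x \<bullet> ((X :: real^'n^'m) *v y))"
  unfolding bilinear_def
  by (auto intro!: linearI simp: inner_simps matrix_vector_right_distrib matrix_vector_mult_scaleR)

lemma bilinear_inner_linear:
  assumes f: "linear f" and g: "linear g"
  shows "bilinear (\<lambda>x y. f x \<bullet> g y)"
  unfolding bilinear_def
  using linear_add[OF f] linear_cmul[OF f] linear_add[OF g] linear_cmul[OF g]
  by (auto intro!: linearI simp: inner_simps)

lemma bilinear_plus: "bilinear f \<Longrightarrow> bilinear g \<Longrightarrow> bilinear (\<lambda>x y. f x y + g x y)"
  and bilinear_minus: "bilinear f \<Longrightarrow> bilinear g \<Longrightarrow> bilinear (\<lambda>x y. f x y - g x y)"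
  unfolding bilinear_def by (auto intro: linear_compose_add linear_compose_sub)

lemma bilinear_cmult: "bilinear f \<Longrightarrow> bilinear (\<lambda>x y. c * f x y :: real)"
  unfolding bilinear_def by (auto intro: linear_compose_scale_right[where 'b=real, simplified])

lemma linear_mv_comp: "linear f \<Longrightarrow> linear (\<lambda>x. (R :: real^'n^'m) *v f x)"
  using linear_compose[OF _ matrix_vector_mul_linear, of f R] by (simp add: o_def)

lemmas linear_simple_intros =
  bilinear_inner_linear bilinear_plus bilinear_minus bilinear_cmult linear_mv_comp linear_fst linear_snd
  linear_compose_sub linear_compose_add linear_compose_scale_right linear_ident

text \<open>The hypotheses are the real and imaginary parts of
  \<open>A (x + i y) = (a + i b) (x + i y)\<close>. Later arguments treat complex vectors as pairs
  of real ones, and only here is such a pair turned into an eigenvalue.\<close>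

lemma is_eigenvalue_real_pair:
  fixes A :: "real^'n^'n"
  assumes "A *v x = a *\<^sub>R x - b *\<^sub>R y" "A *v y = b *\<^sub>R x + a *\<^sub>R y" "x \<noteq> 0 \<or> y \<noteq> 0"
  shows "is_eigenvalue A (Complex a b)"
  unfolding is_eigenvalue_def
proof (intro exI conjI)
  let ?v = "\<chi> i. Complex (x $ i) (y $ i)"
  show "?v \<noteq> 0" using assms(3) by (auto simp: vec_eq_iff complex_eq_iff)
  have "(map_matrix complex_of_real A *v ?v) $ i = Complex ((A *v x) $ i) ((A *v y) $ i)" for i
    by (simp add: map_matrix_def matrix_vector_mult_def complex_eq_iff)
  then show "map_matrix complex_of_real A *v ?v = Complex a b *s ?v"
    by (simp add: assms(1,2) vec_eq_iff complex_eq_iff algebra_simps)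
qed

lemma hurwitz_invertible:
  assumes "hurwitz P"
  obtains R where "P ** R = mat 1" "R ** P = mat 1"
proof -
  have "x = 0" if "P *v x = 0" for x
  proof (rule ccontr)
    assume "x \<noteq> 0"
    then have "is_eigenvalue P (Complex 0 0)"
      using that by (intro is_eigenvalue_real_pair[of _ x _ _ 0]) auto
    then show False using assms by (auto simp: hurwitz_def)
  qed
  then show ?thesis
    using that matrix_left_invertible_ker[of P] matrix_left_right_inverse by metis
qed

lemma quadratic_form_upper_bound:
  fixes f :: "'a::euclidean_space \<Rightarrow> 'a \<Rightarrow> real"
  assumes f: "bilinear f"
  obtains b where "b > 0" "\<And>z. \<bar>f z z\<bar> \<le> b * (norm z)\<^sup>2"
proof -
  obtain B where "B > 0" "\<And>x y. norm (f x y) \<le> B * norm x * norm y"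
    using bilinear_bounded_pos[OF f] by blast
  then show ?thesis using that[of B] by (simp add: power2_eq_square mult_ac)
qed

lemma quadratic_form_lower_bound:
  fixes f :: "'a::euclidean_space \<Rightarrow> 'a \<Rightarrow> real"
  assumes f: "bilinear f" and pos: "\<And>z. z \<noteq> 0 \<Longrightarrow> f z z > 0"
  obtains a where "a > 0" "\<And>z. a * (norm z)\<^sup>2 \<le> f z z"
proof -
  have "continuous_on (sphere 0 1) (\<lambda>z. f z z)"
    by (intro bilinear_continuous_on_compose[OF _ _ f] continuous_intros)
  moreover have "sphere 0 (1::real) \<noteq> ({} :: 'a set)" by simp
  ultimately obtain v where v: "v \<in> sphere 0 1" and min: "\<And>z. z \<in> sphere 0 1 \<Longrightarrow> f v v \<le> f z z"
    using continuous_attains_inf[of "sphere 0 1" "\<lambda>z. f z z"] by (metis compact_sphere)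
  have "f v v * (norm z)\<^sup>2 \<le> f z z" for z
  proof (cases "z = 0")
    case False
    then have "f v v \<le> f (z /\<^sub>R norm z) (z /\<^sub>R norm z)" by (intro min) simp
    then show ?thesis
      using False by (simp add: bilinear_lmul[OF f] bilinear_rmul[OF f] divide_simps power2_eq_square mult_ac)
  qed (simp add: bilinear_lzero[OF f])
  moreover have "v \<noteq> 0" using v by auto
  ultimately show ?thesis using that pos by blast
qed

section \<open>Invariant planes of skew operators\<close>

text \<open>Plays the role of Lagrange multipliers: at an extremum of a quotient of quadratic forms,
  a shifted form is positive semidefinite and vanishes at the extremal vector, which thus satisfies
  the eigenvector equation. If \<open>f v u\<close> were nonzero, a suitable step from
  \<open>v\<close> along \<open>u\<close> would make the form negative.\<close>

lemma psd_form_kernel: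
  fixes f :: "'a::real_vector \<Rightarrow> 'a \<Rightarrow> real"
  assumes f: "bilinear f" and sym: "\<And>u v. f u v = f v u" and S: "subspace S"
    and psd: "\<And>u. u \<in> S \<Longrightarrow> 0 \<le> f u u"
    and v: "v \<in> S" "f v v \<le> 0" and u: "u \<in> S"
  shows "f v u = 0"
proof (rule ccontr)
  assume nz: "f v u \<noteq> 0"
  define q where "q = f u u"
  \<comment> \<open>The bound \<open>2 t f v u + t^2 q\<close> is minimal at
    \<open>t = - f v u / q\<close>; the added 1 covers \<open>q = 0\<close> and still leaves a
    negative value.\<close>
  define t where "t = - f v u / (q + 1)"
  have q: "q \<ge> 0" using psd u by (simp add: q_def)
  have "0 \<le> f (v + t *\<^sub>R u) (v + t *\<^sub>R u)"
    using S u v by (intro psd) (simp add: subspace_add subspace_scale)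
  also have "\<dots> = f v v + 2 * t * f v u + t\<^sup>2 * q"
    using sym[of u v] by (simp add: bilinear_ladd[OF f] bilinear_radd[OF f] bilinear_lmul[OF f]
        bilinear_rmul[OF f] q_def power2_eq_square algebra_simps)
  also have "\<dots> \<le> 2 * t * f v u + t\<^sup>2 * q" using v by simp
  also have "\<dots> = (f v u)\<^sup>2 * (- q - 2) / (q + 1)\<^sup>2"
    using q unfolding t_def by (simp add: divide_simps power2_eq_square) (simp add: algebra_simps)
  also have "\<dots> < 0"
    using q nz by (intro divide_neg_pos mult_pos_neg) auto
  finally show False by simp
qed

text \<open>Basis independence of the trace: expand one argument in \<open>Basis\<close>, swap the
  sums, recombine along \<open>B\<close>.\<close>

lemma orthonormal_bilinear_sum:
  fixes f :: "'a::euclidean_space \<Rightarrow> 'a \<Rightarrow> real"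
  assumes f: "bilinear f" and B: "pairwise orthogonal B" "\<And>b. b \<in> B \<Longrightarrow> norm b = 1"
    "span B = UNIV" "finite B"
  shows "(\<Sum>b\<in>B. f b b) = (\<Sum>b\<in>Basis. f b b)"
proof -
  have lin: "linear (f x)" "linear (\<lambda>y. f y x)" for x
    using f by (auto simp: bilinear_def)
  have "(\<Sum>b\<in>B. f b b) = (\<Sum>b\<in>B. \<Sum>e\<in>Basis. (b \<bullet> e) * f e b)"
  proof (rule sum.cong[OF refl])
    fix b
    have "f b b = f (\<Sum>e\<in>Basis. (b \<bullet> e) *\<^sub>R e) b" by (simp add: euclidean_representation)
    also have "\<dots> = (\<Sum>e\<in>Basis. (b \<bullet> e) * f e b)"
      by (simp add: linear_sum[OF lin(2)] bilinear_lmul[OF f])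
    finally show "f b b = (\<Sum>e\<in>Basis. (b \<bullet> e) * f e b)" .
  qed
  also have "\<dots> = (\<Sum>e\<in>Basis. \<Sum>b\<in>B. (e \<bullet> b) * f e b)"
    by (subst sum.swap) (simp add: inner_commute)
  also have "\<dots> = (\<Sum>e\<in>Basis. f e e)"
  proof (rule sum.cong[OF refl])
    fix e :: 'a
    have "f e e = f e (\<Sum>b\<in>B. (e \<bullet> b) *\<^sub>R b)"
      using orthonormal_basis_expand[OF B(1,2) _ B(4), of e] B(3) by simp
    also have "\<dots> = (\<Sum>b\<in>B. (e \<bullet> b) * f e b)"
      by (simp add: linear_sum[OF lin(1)] bilinear_rmul[OF f])
    finally show "(\<Sum>b\<in>B. (e \<bullet> b) * f e b) = f e e" by simp
  qed
  finally show ?thesis .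
qed

text \<open>Subtracting from \<open>x\<close> its projection \<open>y\<close> onto the span of
  \<open>C\<close> leaves a vector of the complement. Used to put an invariant plane beside a basis
  of its complement, and a kernel beside its complement.\<close>

lemma orthonormal_union_complement:
  fixes S :: "'a::euclidean_space set"
  assumes S: "subspace S" and C: "C \<subseteq> S" "pairwise orthogonal C" "\<And>c. c \<in> C \<Longrightarrow> norm c = 1" "finite C"
    and B: "B \<subseteq> S \<inter> {x. \<forall>c\<in>C. orthogonal c x}" "pairwise orthogonal B" "\<And>b. b \<in> B \<Longrightarrow> norm b = 1"
      "span B = S \<inter> {x. \<forall>c\<in>C. orthogonal c x}"
  shows "C \<inter> B = {}" "pairwise orthogonal (C \<union> B)" "span (C \<union> B) = S" "finite B"
proof -
  show "C \<inter> B = {}"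
  proof (rule ccontr)
    assume "C \<inter> B \<noteq> {}"
    then obtain x where x: "x \<in> C" "x \<in> B" by blast
    then have "orthogonal x x" using B(1) by auto
    then show False using C(3)[OF x(1)] by (simp add: orthogonal_self)
  qed
  have "orthogonal c b" "orthogonal b c" if "c \<in> C" "b \<in> B" for c b
    using that B(1) by (auto simp: orthogonal_commute)
  then show "pairwise orthogonal (C \<union> B)"
    using C(2) B(2) by (auto simp: pairwise_def)
  show "finite B"
    using B(2,3) pairwise_orthogonal_imp_finite by blast
  show "span (C \<union> B) = S"
  proof
    show "span (C \<union> B) \<subseteq> S" using C(1) B(1) S by (intro span_minimal) auto
    show "S \<subseteq> span (C \<union> B)"
    proof
      fix x assume x: "x \<in> S"
      define y where "y = (\<Sum>c\<in>C. (x \<bullet> c) *\<^sub>R c)"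
      have yC: "y \<in> span C" unfolding y_def by (intro span_sum span_scale span_base)
      have "c \<bullet> (x - y) = 0" if "c \<in> C" for c
      proof -
        have "c \<bullet> y = (\<Sum>d\<in>C. (x \<bullet> d) * (c \<bullet> d))" by (simp add: y_def inner_sum_right)
        also have "\<dots> = (\<Sum>d\<in>C. if d = c then x \<bullet> c else 0)"
        proof (rule sum.cong[OF refl])
          fix d assume d: "d \<in> C"
          show "(x \<bullet> d) * (c \<bullet> d) = (if d = c then x \<bullet> c else 0)"
            using C(2,3) d that by (auto simp: pairwise_def orthogonal_def norm_eq_1)
        qed
        also have "\<dots> = x \<bullet> c" using C(4) that by simp
        finally show ?thesis by (simp add: inner_diff_right inner_commute)
      qed
      moreover have "y \<in> S" using yC C(1) S span_minimal by blast
      ultimately have "x - y \<in> span B"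
        using B(4) x S by (simp add: orthogonal_def subspace_diff)
      then have "y + (x - y) \<in> span (C \<union> B)"
        using yC span_mono[of C "C \<union> B"] span_mono[of B "C \<union> B"] by (intro span_add) auto
      then show "x \<in> span (C \<union> B)" by simp
    qed
  qed
qed

text \<open>On \<open>S\<close> the operator \<open>- \<Omega>^2\<close> is symmetric and positive
  semidefinite, so a unit vector \<open>v\<close> maximizing \<open>|\<Omega> v|\<close> is an
  eigenvector of it, with eigenvalue \<open>\<mu> = k^2\<close>, and \<open>v\<close>,
  \<open>\<Omega> v\<close> span an invariant plane. For \<open>\<mu> = 0\<close> the plane
  degenerates to a line in the kernel, encoded by \<open>k = 0\<close> and
  \<open>w = 0\<close>.\<close>

lemma skew_eigenplane:
  fixes \<Omega> :: "'a::euclidean_space \<Rightarrow> 'a"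
  assumes \<Omega>: "linear \<Omega>" "\<And>v. v \<in> S \<Longrightarrow> \<Omega> v \<in> S"
    and skew: "\<And>u v. u \<in> S \<Longrightarrow> v \<in> S \<Longrightarrow> \<Omega> u \<bullet> v = - (u \<bullet> \<Omega> v)"
    and S: "subspace S" "S \<noteq> {0}"
  obtains v w k where "v \<in> S" "norm v = 1" "w \<in> S" "\<Omega> v = - k *\<^sub>R w" "\<Omega> w = k *\<^sub>R v"
    "(k = 0 \<and> w = 0) \<or> (norm w = 1 \<and> v \<bullet> w = 0)"
proof -
  interpret \<Omega>: linear \<Omega> by fact
  obtain x where x: "x \<in> S" "x \<noteq> 0" using S subspace_0[OF S(1)] by blast
  have "compact (sphere 0 1 \<inter> S)"
    using closed_subspace[OF S(1)] by (intro compact_Int_closed) auto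
  moreover have "x /\<^sub>R norm x \<in> sphere 0 1 \<inter> S" using x S(1) by (simp add: subspace_scale)
  moreover have "continuous_on (sphere 0 1 \<inter> S) (\<lambda>v. \<Omega> v \<bullet> \<Omega> v)"
    by (intro continuous_intros linear_continuous_on linear_conv_bounded_linear[THEN iffD1] \<Omega>)
  ultimately obtain v where v: "v \<in> sphere 0 1 \<inter> S"
    and max: "\<And>u. u \<in> sphere 0 1 \<inter> S \<Longrightarrow> \<Omega> u \<bullet> \<Omega> u \<le> \<Omega> v \<bullet> \<Omega> v"
    using continuous_attains_sup[of "sphere 0 1 \<inter> S" "\<lambda>v. \<Omega> v \<bullet> \<Omega> v"] by blast
  define \<mu> where "\<mu> = \<Omega> v \<bullet> \<Omega> v"
  have vS: "v \<in> S" and nv: "norm v = 1" using v by auto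
  \<comment> \<open>Positive semidefinite on \<open>S\<close> because \<mu> is the maximum, and zero
    at \<open>v\<close>; so \<open>v\<close> lies in its radical.\<close>
  define f where "f = (\<lambda>u w. \<mu> * (u \<bullet> w) - \<Omega> u \<bullet> \<Omega> w)"
  have bil: "bilinear f"
    unfolding bilinear_def f_def
    by (auto intro!: linearI simp: \<Omega>.add \<Omega>.scale inner_simps algebra_simps)
  have psd: "0 \<le> f u u" if u: "u \<in> S" for u
  proof (cases "u = 0")
    case False
    have "\<Omega> (u /\<^sub>R norm u) \<bullet> \<Omega> (u /\<^sub>R norm u) \<le> \<mu>"
      unfolding \<mu>_def using u False S(1) by (intro max) (simp add: subspace_scale)
    then show ?thesis
      using False by (simp add: f_def \<Omega>.scale divide_simps dot_square_norm power2_eq_square mult_ac)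
  qed (simp add: f_def \<Omega>.zero)
  have "f v u = 0" if "u \<in> S" for u
  proof (rule psd_form_kernel[OF bil _ S(1) psd vS _ that])
    show "f v v \<le> 0" using nv by (simp add: f_def \<mu>_def norm_eq_1)
  qed (simp add: f_def inner_commute)
  then have eig: "\<Omega> v \<bullet> \<Omega> u = \<mu> * (v \<bullet> u)" if "u \<in> S" for u
    using that by (simp add: f_def)
  have \<Omega>\<Omega>: "\<Omega> (\<Omega> v) = - \<mu> *\<^sub>R v"
  proof -
    define d where "d = \<Omega> (\<Omega> v) + \<mu> *\<^sub>R v"
    have dS: "d \<in> S" unfolding d_def using \<Omega>(2) vS S(1) by (simp add: subspace_add subspace_scale)
    have "d \<bullet> d = \<Omega> (\<Omega> v) \<bullet> d + \<mu> * (v \<bullet> d)"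
      by (subst (1) d_def) (simp add: inner_add_left)
    also have "\<dots> = 0" using skew[OF \<Omega>(2)[OF vS] dS] eig[OF dS] by simp
    finally show ?thesis by (simp add: d_def eq_neg_iff_add_eq_0)
  qed
  show ?thesis
  proof (cases "\<mu> = 0")
    case True
    then have "\<Omega> v = 0" by (simp add: \<mu>_def)
    then show ?thesis
      using that[of v 0 0] vS nv S(1) by (simp add: subspace_0 \<Omega>.zero)
  next
    case False
    then have pos: "\<mu> > 0" unfolding \<mu>_def by (simp add: order_le_neq_trans)
    define k where "k = sqrt \<mu>"
    have k: "k > 0" "k * k = \<mu>" using pos by (auto simp: k_def)
    define w where "w = - (1 / k) *\<^sub>R \<Omega> v"
    have "w \<in> S" unfolding w_def using \<Omega>(2) vS S(1) by (simp add: subspace_scale subspace_neg)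
    moreover have "\<Omega> v = - k *\<^sub>R w" using k by (simp add: w_def)
    moreover have "\<Omega> w = k *\<^sub>R v"
      unfolding w_def using k by (simp add: \<Omega>.scale \<Omega>.neg \<Omega>\<Omega> field_simps flip: k(2))
    moreover have "norm w = 1"
      using k by (simp add: w_def norm_eq_sqrt_inner[of "\<Omega> v"] flip: \<mu>_def) (simp add: k_def)
    moreover have "v \<bullet> w = 0"
      using skew[OF vS vS] by (simp add: w_def inner_commute)
    ultimately show ?thesis using that vS nv by blast
  qed
qed

text \<open>Split off one plane, recurse in its orthogonal complement inside \<open>S\<close>, and
  group the sum by planes, each of which contributes a negative amount. The strict conclusion needs
  \<open>S\<close> nontrivial, since an empty basis has sum 0. Later \<open>\<theta> v\<close> is
  \<open>f v v\<close>.\<close>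

lemma skew_orthonormal_basis_neg:
  fixes \<Omega> :: "'a::euclidean_space \<Rightarrow> 'a" and \<theta> :: "'a \<Rightarrow> real"
  assumes \<Omega>: "linear \<Omega>" "\<And>v. v \<in> S \<Longrightarrow> \<Omega> v \<in> S"
    and skew: "\<And>u v. u \<in> S \<Longrightarrow> v \<in> S \<Longrightarrow> \<Omega> u \<bullet> v = - (u \<bullet> \<Omega> v)"
    and S: "subspace S" and \<theta>0: "\<theta> 0 = 0"
    and neg: "\<And>k v w. v \<in> S \<Longrightarrow> w \<in> S \<Longrightarrow> \<Omega> v = - k *\<^sub>R w \<Longrightarrow> \<Omega> w = k *\<^sub>R v \<Longrightarrow> v \<noteq> 0 \<Longrightarrow> \<theta> v + \<theta> w < 0"
  obtains B where "B \<subseteq> S" "pairwise orthogonal B" "\<And>b. b \<in> B \<Longrightarrow> norm b = 1" "span B = S"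
    "finite B" "(\<Sum>b\<in>B. \<theta> b) \<le> 0" "S \<noteq> {0} \<longrightarrow> (\<Sum>b\<in>B. \<theta> b) < 0"
proof -
  have "\<exists>B. B \<subseteq> S \<and> pairwise orthogonal B \<and> (\<forall>b\<in>B. norm b = 1) \<and> span B = S \<and>
    finite B \<and> (\<Sum>b\<in>B. \<theta> b) \<le> 0 \<and> (S \<noteq> {0} \<longrightarrow> (\<Sum>b\<in>B. \<theta> b) < 0)"
    using \<Omega>(2) skew S neg
  proof (induction "dim S" arbitrary: S rule: less_induct)
    case less
    show ?case
    proof (cases "S = {0}")
      case True
      then show ?thesis by (intro exI[of _ "{}"]) auto
    next
      case False
      from skew_eigenplane[OF \<Omega>(1) less.prems(1,2,3) False]
      obtain v w k where vw: "v \<in> S" "norm v = 1" "w \<in> S" "\<Omega> v = - k *\<^sub>R w" "\<Omega> w = k *\<^sub>R v"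
        and alt: "(k = 0 \<and> w = 0) \<or> (norm w = 1 \<and> v \<bullet> w = 0)" by blast
      have "v \<noteq> 0" using vw(2) by auto
      have lt: "\<theta> v + \<theta> w < 0" using less.prems(4)[OF vw(1,3,4,5) \<open>v \<noteq> 0\<close>] .
      define C where "C = (if w = 0 then {v} else {v, w})"
      have "v \<noteq> w" if "w \<noteq> 0" using alt that vw(2) by auto
      \<comment> \<open>If \<open>w = 0\<close>, then \<open>C\<close> contains only
        \<open>v\<close>; \<open>\<theta>0\<close> lets the same formula cover this case.\<close>
      then have sumC: "(\<Sum>c\<in>C. \<theta> c) = \<theta> v + \<theta> w" by (auto simp: C_def \<theta>0)
      have C: "C \<subseteq> S" "pairwise orthogonal C" "\<And>c. c \<in> C \<Longrightarrow> norm c = 1" "finite C"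
        using vw alt by (auto simp: C_def pairwise_def orthogonal_def inner_commute split: if_splits)
      define S' where "S' = S \<inter> {x. \<forall>c\<in>C. orthogonal c x}"
      have sub: "subspace S'"
        unfolding S'_def using less.prems(3) subspace_orthogonal_to_vectors[of C]
        by (intro subspace_inter) (auto simp: orthogonal_commute)
      have S'iff: "u \<in> S' \<longleftrightarrow> u \<in> S \<and> u \<bullet> v = 0 \<and> u \<bullet> w = 0" for u
        by (auto simp: S'_def C_def orthogonal_def inner_commute)
      have "v \<notin> S'" using \<open>v \<noteq> 0\<close> by (simp add: S'iff)
      then have "S' \<subset> S" using vw(1) S'iff by blast
      then have "dim S' < dim S"
        using less.prems(3) sub by (intro dim_psubset) (simp add: span_eq_iff[THEN iffD2])
      \<comment> \<open>Skewness moves \<Omega> to the other factor, where it sends \<open>v\<close>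
        and \<open>w\<close> to multiples of each other.\<close>
      moreover have "\<Omega> u \<in> S'" if u: "u \<in> S'" for u
        using u less.prems(1)[of u] less.prems(2)[of u v] less.prems(2)[of u w] vw
        by (simp add: S'iff)
      ultimately have "\<exists>B\<subseteq>S'. pairwise orthogonal B \<and> (\<forall>b\<in>B. norm b = 1) \<and> span B = S' \<and>
          finite B \<and> (\<Sum>b\<in>B. \<theta> b) \<le> 0 \<and> (S' \<noteq> {0} \<longrightarrow> (\<Sum>b\<in>B. \<theta> b) < 0)"
        using sub S'iff by (intro less.hyps) (auto intro: less.prems)
      then obtain B where B: "B \<subseteq> S'" "pairwise orthogonal B" "\<And>b. b \<in> B \<Longrightarrow> norm b = 1"
        "span B = S'" "finite B" "(\<Sum>b\<in>B. \<theta> b) \<le> 0"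
        by blast
      note U = orthonormal_union_complement[OF less.prems(3) C B(1,2,3,4)[unfolded S'_def]]
      have "(\<Sum>b\<in>C \<union> B. \<theta> b) < 0"
        using U C(4) lt sumC B(6) by (subst sum.union_disjoint) auto
      moreover have "C \<union> B \<subseteq> S" using C(1) B(1) S'iff by blast
      ultimately show ?thesis using U C B by (intro exI[of _ "C \<union> B"]) auto
    qed
  qed
  then show ?thesis using that by blast
qed

section \<open>The Kalman--Yakubovich--Popov lemma\<close>

text \<open>On the orthogonal complement of the kernel of \<open>X\<close> one has \<open>Y = X \<Omega>\<close> with \<open>\<Omega>\<close> skew, and the
  trace is a sum over invariant planes of \<open>\<Omega>\<close>.\<close>

lemma skew_pencil_trace_neg:
  fixes X Y :: "'e::euclidean_space \<Rightarrow> 'b::euclidean_space"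
  assumes X: "linear X" and Y: "linear Y" and f: "bilinear f"
    and skew: "\<And>u w. Y (adjoint X u) \<bullet> w + Y (adjoint X w) \<bullet> u = 0"
    and ker: "\<And>v. X v = 0 \<Longrightarrow> f v v \<le> (0::real)"
    and neg: "\<And>k v w. X v \<noteq> 0 \<Longrightarrow> Y v = - k *\<^sub>R X w \<Longrightarrow> Y w = k *\<^sub>R X v \<Longrightarrow> f v v + f w w < 0"
    and nz: "X x \<noteq> 0"
  shows "(\<Sum>b\<in>Basis. f b b) < 0"
proof -
  interpret X: linear X by fact
  interpret Y: linear Y by fact
  have adj: "adjoint X u \<bullet> v = u \<bullet> X v" for u v
    using adjoint_works[OF X, of v u] by (simp add: inner_commute)
  define K where "K = {v. X v = 0}"
  have subK: "subspace K" unfolding K_def subspace_def by (simp add: X.zero X.add X.scale)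
  obtain C where C: "C \<subseteq> K" "pairwise orthogonal C" "\<And>c. c \<in> C \<Longrightarrow> norm c = 1" "span C = K"
    using orthonormal_basis_subspace[OF subK] by metis
  have finC: "finite C" using C by (intro pairwise_orthogonal_imp_finite) auto
  define S where "S = UNIV \<inter> {x. \<forall>c\<in>C. orthogonal c x}"
  have subS: "subspace S" using subspace_orthogonal_to_vectors[of C] by (simp add: S_def)
  have S_perp: "S = K\<^sup>\<bottom>"
  proof
    show "K\<^sup>\<bottom> \<subseteq> S" using C(1) by (auto simp: S_def orthogonal_comp_def)
    show "S \<subseteq> K\<^sup>\<bottom>"
    proof
      fix x assume "x \<in> S"
      then have "orthogonal x y" if "y \<in> K" for y
        using that orthogonal_to_span[of y C x] C(4) by (auto simp: S_def orthogonal_commute)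
      then show "x \<in> K\<^sup>\<bottom>" by (simp add: orthogonal_comp_def orthogonal_commute)
    qed
  qed
  have rng: "\<exists>u. v = adjoint X u" if "v \<in> S" for v
  proof -
    have "K = (range (adjoint X))\<^sup>\<bottom>"
      using ker_orthogonal_comp_adjoint[OF X] by (auto simp: K_def)
    moreover have "subspace (range (adjoint X))"
      using adjoint_linear[OF X] by (simp add: linear_subspace_image)
    ultimately have "K\<^sup>\<bottom> = range (adjoint X)" by (simp add: orthogonal_comp_self)
    then show ?thesis using that S_perp by auto
  qed
  have KS: "v = 0" if "v \<in> K" "v \<in> S" for v
    using that unfolding S_perp by (auto simp: orthogonal_comp_def orthogonal_self)
  have "inj_on X S"
  proof (rule inj_onI)
    fix u v assume "u \<in> S" "v \<in> S" "X u = X v"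
    then have "u - v = 0" using subS by (intro KS) (simp_all add: K_def X.diff subspace_diff)
    then show "u = v" by simp
  qed
  then obtain g where g: "range g \<subseteq> S" "linear g" "\<And>v. v \<in> S \<Longrightarrow> g (X v) = v"
    using linear_exists_left_inverse_on[OF X subS] by blast
  define \<Omega> where "\<Omega> = g \<circ> Y"
  have lin\<Omega>: "linear \<Omega>" unfolding \<Omega>_def by (intro linear_compose Y g)
  have \<Omega>S: "\<Omega> v \<in> S" for v using g(1) by (auto simp: \<Omega>_def)
  \<comment> \<open>For \<open>v = adjoint X u\<close>, skewness says
    \<open>Y v = - X (adjoint Y u)\<close>, so \<open>Y v\<close> lies in the range of
    \<open>X\<close>. Dropping the part \<open>n\<close> of \<open>adjoint Y u\<close> in the kernel
    of \<open>X\<close> leaves a preimage in \<open>S\<close>, which is the one that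
    \<open>g\<close> returns.\<close>
  have X\<Omega>: "X (\<Omega> v) = Y v" if vS: "v \<in> S" for v
  proof -
    obtain u where u: "v = adjoint X u" using rng vS by blast
    obtain s n where sn: "s \<in> S" "\<And>w. w \<in> S \<Longrightarrow> orthogonal n w" "adjoint Y u = s + n"
      using orthogonal_subspace_decomp_exists[of S "adjoint Y u"] subS
      by (metis span_eq_iff)
    have "n \<in> S\<^sup>\<bottom>" using sn(2) by (auto simp: orthogonal_comp_def orthogonal_commute)
    then have "X n = 0" using subK by (simp add: S_perp orthogonal_comp_self K_def)
    then have Xs: "X s = X (adjoint Y u)" by (simp add: sn(3) X.add)
    have "X (adjoint Y u) \<bullet> w = - (Y v) \<bullet> w" for w
      using skew[of u w] adjoint_works[OF X, of "adjoint Y u" w] adjoint_works[OF Y, of "adjoint X w" u]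
      by (simp add: u inner_commute)
    then have "X (adjoint Y u) = - Y v" by (metis vector_eq_rdot)
    then have Yv: "Y v = X (- s)" using Xs by (simp add: X.neg)
    then have "\<Omega> v = - s" using g(3)[of "- s"] sn(1) subS by (simp add: \<Omega>_def subspace_neg)
    then show ?thesis using Yv by simp
  qed
  have sk: "\<Omega> u \<bullet> v = - (u \<bullet> \<Omega> v)" if uv: "u \<in> S" "v \<in> S" for u v
  proof -
    obtain a b where ab: "u = adjoint X a" "v = adjoint X b" using rng uv by blast
    have "\<Omega> u \<bullet> v = Y u \<bullet> b" using adj[of b "\<Omega> u"] X\<Omega>[OF uv(1)] ab by (simp add: inner_commute)
    also have "\<dots> = - (Y v \<bullet> a)" using skew[of a b] ab by simp
    also have "\<dots> = - (u \<bullet> \<Omega> v)" using adj[of a "\<Omega> v"] X\<Omega>[OF uv(2)] ab by (simp add: inner_commute)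
    finally show ?thesis .
  qed
  have f0: "f 0 0 = 0" by (simp add: bilinear_lzero[OF f])
  obtain B where B: "B \<subseteq> S" "pairwise orthogonal B" "\<And>b. b \<in> B \<Longrightarrow> norm b = 1" "span B = S"
    "finite B" "S \<noteq> {0} \<longrightarrow> (\<Sum>b\<in>B. f b b) < 0"
  proof (rule skew_orthonormal_basis_neg[OF lin\<Omega> \<Omega>S sk subS, of "\<lambda>v. f v v"])
    fix k v w assume "v \<in> S" "w \<in> S" "\<Omega> v = - k *\<^sub>R w" "\<Omega> w = k *\<^sub>R v" "v \<noteq> 0"
    then show "f v v + f w w < 0"
      using X\<Omega>[of v] X\<Omega>[of w] KS[of v] by (intro neg[of v k w]) (auto simp: X.scale X.neg K_def)
  qed (use f0 in auto)
  note U = orthonormal_union_complement[OF subspace_UNIV subset_UNIV C(2,3) finC B(1,2,3,4)[unfolded S_def]]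
  \<comment> \<open>Strictness has to come from \<open>S\<close>: the kernel vectors are only known
    to contribute a nonpositive amount.\<close>
  have "S \<noteq> {0}"
  proof
    assume "S = {0}"
    then have "K = UNIV" using orthogonal_comp_self[OF subK] by (simp add: S_perp)
    then show False using nz by (auto simp: K_def)
  qed
  then have "(\<Sum>b\<in>B. f b b) < 0" using B(6) by blast
  moreover have "(\<Sum>c\<in>C. f c c) \<le> 0"
    using C(1) by (intro sum_nonpos ker) (auto simp: K_def)
  ultimately have "(\<Sum>b\<in>C \<union> B. f b b) < 0"
    using U finC by (subst sum.union_disjoint) auto
  moreover have "(\<Sum>b\<in>C \<union> B. f b b) = (\<Sum>b\<in>Basis. f b b)"
    using U finC C(3) B(3,5) by (intro orthonormal_bilinear_sum[OF f]) auto
  ultimately show ?thesis by simp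
qed

text \<open>Caratheodory's theorem, with the \<open>DIM('p) + 1\<close> points indexed by a basis, so that the coefficient
  vectors of linear combinations of them form a Euclidean space.\<close>

lemma convex_hull_image_Basis:
  fixes \<phi> :: "'z \<Rightarrow> 'p::euclidean_space"
  assumes "x \<in> convex hull (\<phi> ` S)"
  obtains z c where "\<And>b. z b \<in> S" "\<And>b. 0 \<le> c b" "sum c Basis = 1"
    "x = (\<Sum>b\<in>(Basis :: ('p \<times> real) set). c b *\<^sub>R \<phi> (z b))"
proof -
  obtain T where T: "finite T" "T \<subseteq> \<phi> ` S" "card T \<le> DIM('p) + 1" "x \<in> convex hull T"
    using assms caratheodory[of "\<phi> ` S"] by auto
  then obtain u where u: "\<forall>x\<in>T. 0 \<le> u x" "sum u T = 1" "(\<Sum>v\<in>T. u v *\<^sub>R v) = x"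
    unfolding convex_hull_finite[OF T(1)] by blast
  have "\<exists>h. h ` T \<subseteq> (Basis :: ('p \<times> real) set) \<and> inj_on h T"
    using card_le_inj[OF T(1), of "Basis :: ('p \<times> real) set"] T(3) by simp
  then obtain h where h: "h ` T \<subseteq> (Basis :: ('p \<times> real) set)" "inj_on h T" by blast
  have "T \<noteq> {}" using T(4) by auto
  then obtain s0 where s0: "s0 \<in> S" using T(2) by blast
  define g where "g = inv_into T h"
  have g: "g (h v) = v" if "v \<in> T" for v using that h(2) by (simp add: g_def)
  \<comment> \<open>Basis elements that \<open>h\<close> does not reach are padding: weight 0 and an
    arbitrary point \<open>s0\<close> of \<open>S\<close>.\<close>
  define z where "z b = (if b \<in> h ` T then (SOME s. s \<in> S \<and> \<phi> s = g b) else s0)" for b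
  define c where "c b = (if b \<in> h ` T then u (g b) else 0)" for b
  have z: "z (h v) \<in> S \<and> \<phi> (z (h v)) = v" if v: "v \<in> T" for v
  proof -
    have "\<exists>s. s \<in> S \<and> \<phi> s = v" using T(2) v by blast
    then have "(SOME s. s \<in> S \<and> \<phi> s = v) \<in> S \<and> \<phi> (SOME s. s \<in> S \<and> \<phi> s = v) = v" by (rule someI_ex)
    then show ?thesis using v by (simp add: z_def g)
  qed
  have sum_scale: "(\<Sum>b\<in>Basis. c b *\<^sub>R F b) = (\<Sum>v\<in>T. u v *\<^sub>R F (h v))" for F :: "'p \<times> real \<Rightarrow> 'p"
  proof -
    have "(\<Sum>b\<in>Basis. c b *\<^sub>R F b) = (\<Sum>b\<in>h ` T. c b *\<^sub>R F b)"
      using h(1) by (intro sum.mono_neutral_right) (auto simp: c_def)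
    also have "\<dots> = (\<Sum>v\<in>T. u v *\<^sub>R F (h v))"
      using h(2) by (subst sum.reindex) (auto simp: c_def g intro!: sum.cong)
    finally show ?thesis .
  qed
  have "sum c Basis = sum c (h ` T)"
    using h(1) by (intro sum.mono_neutral_right) (auto simp: c_def)
  also have "\<dots> = sum u T"
    using h(2) by (subst sum.reindex) (auto simp: c_def g intro!: sum.cong)
  finally have sum_c: "sum c Basis = 1" using u(2) by simp
  show ?thesis
  proof
    show "z b \<in> S" for b
    proof (cases "b \<in> h ` T")
      case False then show ?thesis using s0 by (simp add: z_def)
    next
      case True then show ?thesis using z by blast
    qed
    show "0 \<le> c b" for b using u(1) g by (auto simp: c_def)
    show "sum c Basis = 1" by (rule sum_c)
    show "x = (\<Sum>b\<in>Basis. c b *\<^sub>R \<phi> (z b))"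
      using sum_scale[of "\<lambda>b. \<phi> (z b)"] u(3) z by (simp cong: sum.cong)
  qed
qed

definition outer :: "real^'k \<Rightarrow> real^'k \<Rightarrow> real^'k^'k" where
  "outer a b = (\<chi> i j. a $ i * b $ j)"

text \<open>The form \<open>a \<bullet> (X *v b)\<close> becomes a linear functional of
  \<open>X\<close>, namely the Frobenius product with the rank-one matrix \<open>a b^T\<close>. This
  turns the search for \<open>X\<close> into a separation of convex sets of matrices.\<close>

lemma inner_outer: "X \<bullet> outer a b = a \<bullet> (X *v b)"
  by (simp add: outer_def inner_vec_def matrix_vector_mult_def sum_distrib_left mult_ac)

lemma outer_inner_outer: "outer a b \<bullet> outer c d = (a \<bullet> c) * (b \<bullet> d)"
  by (simp add: outer_def inner_vec_def sum_product mult_ac)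

text \<open>The last hypothesis is the frequency condition \<open>A \<zeta> = i k B \<zeta>\<close> for the complex vector
  \<open>\<zeta> = z + i w\<close>, written in real coordinates.\<close>

theorem kyp_lemma:
  fixes A B :: "'z::euclidean_space \<Rightarrow> real^'k"
  assumes A: "linear A" and B: "linear B" and f: "bilinear f"
    and ker: "\<And>z. B z = 0 \<Longrightarrow> z \<noteq> 0 \<Longrightarrow> f z z < (0::real)"
    and neg: "\<And>k z w. B z \<noteq> 0 \<Longrightarrow> A z = - k *\<^sub>R B w \<Longrightarrow> A w = k *\<^sub>R B z \<Longrightarrow> f z z + f w w < 0"
  obtains X s where "transpose X = X" "s \<ge> 0" "\<And>z. z \<noteq> 0 \<Longrightarrow> A z \<bullet> (X *v B z) + s * f z z < 0"
proof -
  \<comment> \<open>Pairing \<open>(M, s)\<close> with \<open>\<phi> z\<close> gives the left-hand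
    side of the claim for \<open>X = M + transpose M\<close>. A suitable pair is therefore a
    hyperplane with \<open>W\<close> strictly on its negative side and \<open>s \<ge> 0\<close>; the
    obstruction to it is a point \<open>(0, r)\<close> of \<open>W\<close> with
    \<open>r \<ge> 0\<close>.\<close>
  define \<phi> where "\<phi> z = (outer (A z) (B z) + outer (B z) (A z), f z z)" for z
  define W where "W = convex hull (\<phi> ` sphere 0 1)"
  have contA: "continuous_on S A" and contB: "continuous_on S B" for S
    using A B linear_conv_bounded_linear linear_continuous_on by blast+
  have "continuous_on (sphere 0 1) \<phi>"
    unfolding \<phi>_def outer_def
    by (intro continuous_intros contA contB bilinear_continuous_on_compose[OF _ _ f])
  then have "compact W" unfolding W_def
    by (intro compact_convex_hull compact_continuous_image) auto
  have "sphere 0 (1::real) \<noteq> ({} :: 'z set)" by simp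
  then have "W \<noteq> {}" by (auto simp: W_def)
  have disj: "W \<inter> ({0} \<times> {0..}) = {}"
  proof (rule ccontr)
    assume "W \<inter> ({0} \<times> {0..}) \<noteq> {}"
    then obtain r where r: "(0, r) \<in> W" "r \<ge> 0" by auto
    obtain z :: "((real^'k^'k) \<times> real) \<times> real \<Rightarrow> 'z" and c where z: "\<And>b. z b \<in> sphere 0 1"
      and c: "\<And>b. 0 \<le> c b" "sum c Basis = 1" and eq: "(0, r) = (\<Sum>b\<in>Basis. c b *\<^sub>R \<phi> (z b))"
      using convex_hull_image_Basis[OF r(1)[unfolded W_def]] by blast
    \<comment> \<open>The images of the basis are the vectors \<open>sqrt (c b) z b\<close>; the
      square root gives quadratic expressions in them the weights \<open>c b\<close>.\<close>
    define Z where "Z e = (\<Sum>b\<in>Basis. (e \<bullet> b) *\<^sub>R (sqrt (c b) *\<^sub>R z b))" for e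
    have linZ: "linear Z"
      unfolding Z_def by (intro linearI) (simp_all add: inner_add_left algebra_simps sum.distrib scaleR_sum_right)
    have Zb: "Z b = sqrt (c b) *\<^sub>R z b" if "b \<in> Basis" for b
    proof -
      have "Z b = (\<Sum>b'\<in>Basis. if b' = b then sqrt (c b) *\<^sub>R z b else 0)"
        unfolding Z_def using that by (intro sum.cong) (auto simp: inner_Basis)
      then show ?thesis using that by simp
    qed
    define X where "X = B \<circ> Z"
    define Y where "Y = A \<circ> Z"
    have linX: "linear X" and linY: "linear Y" unfolding X_def Y_def by (auto intro: linear_compose linZ A B)
    have XYb: "X b = sqrt (c b) *\<^sub>R B (z b)" "Y b = sqrt (c b) *\<^sub>R A (z b)" if "b \<in> Basis" for b
      using that A B by (auto simp: X_def Y_def Zb linear_cmul)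
    define F where "F u v = f (Z u) (Z v)" for u v
    have bilF: "bilinear F"
      using f linZ unfolding bilinear_def F_def
      by (auto intro: linear_compose[of Z, unfolded o_def])
    have sumF: "(\<Sum>b\<in>Basis. F b b) = r"
    proof -
      have "F b b = c b * f (z b) (z b)" if "b \<in> Basis" for b
        using that c(1)[of b] by (simp add: F_def Zb bilinear_lmul[OF f] bilinear_rmul[OF f])
      moreover have "r = (\<Sum>b\<in>Basis. c b * f (z b) (z b))"
        using arg_cong[OF eq, of snd] by (simp add: \<phi>_def snd_sum)
      ultimately show ?thesis by simp
    qed
    have adj: "Y (adjoint X u) \<bullet> w = (\<Sum>b\<in>Basis. (u \<bullet> X b) * (Y b \<bullet> w))" for u w
    proof -
      have "adjoint X u = (\<Sum>b\<in>Basis. (u \<bullet> X b) *\<^sub>R b)"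
        using adjoint_works[OF linX, of _ u]
        by (subst euclidean_representation[symmetric]) (simp add: inner_commute)
      then show ?thesis
        by (simp add: linear_sum[OF linY] linear_cmul[OF linY] inner_sum_left)
    qed
    have sq: "sqrt (c b) * (sqrt (c b) * x) = c b * x" for b x
      using c(1)[of b] by (simp flip: mult.assoc)
    \<comment> \<open>The zero matrix component of \<open>(0, r)\<close> says that the symmetric
      part of \<open>A Z (B Z)^T\<close> vanishes; pairing it with \<open>outer u w\<close> gives
      this identity.\<close>
    have skew: "Y (adjoint X u) \<bullet> w + Y (adjoint X w) \<bullet> u = 0" for u w
    proof -
      have "Y (adjoint X u) \<bullet> w + Y (adjoint X w) \<bullet> u =
          (\<Sum>b\<in>Basis. (u \<bullet> X b) * (Y b \<bullet> w) + (w \<bullet> X b) * (Y b \<bullet> u))"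
        by (simp add: adj sum.distrib)
      also have "\<dots> = (\<Sum>b\<in>Basis. c b *\<^sub>R (outer (A (z b)) (B (z b)) + outer (B (z b)) (A (z b)))) \<bullet> outer u w"
        unfolding inner_sum_left
      proof (intro sum.cong refl)
        fix b :: "((real^'k^'k) \<times> real) \<times> real" assume "b \<in> Basis"
        then show "(u \<bullet> X b) * (Y b \<bullet> w) + (w \<bullet> X b) * (Y b \<bullet> u) =
          c b *\<^sub>R (outer (A (z b)) (B (z b)) + outer (B (z b)) (A (z b))) \<bullet> outer u w"
          by (simp add: sq XYb inner_add_left outer_inner_outer inner_commute algebra_simps)
      qed
      also have "(\<Sum>b\<in>Basis. c b *\<^sub>R (outer (A (z b)) (B (z b)) + outer (B (z b)) (A (z b)))) = 0"
        using arg_cong[OF eq, of fst] by (simp add: \<phi>_def fst_sum)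
      finally show ?thesis by simp
    qed
    have kerF: "F v v \<le> 0" if "X v = 0" for v
      using ker[of "Z v"] that bilinear_lzero[OF f] by (cases "Z v = 0") (auto simp: F_def X_def)
    show False
    proof (cases "\<exists>x. X x \<noteq> 0")
      case True
      then obtain x where "X x \<noteq> 0" by blast
      then have "(\<Sum>b\<in>Basis. F b b) < 0"
        using neg by (intro skew_pencil_trace_neg[OF linX linY bilF skew kerF]) (auto simp: F_def X_def Y_def)
      then show False using sumF r(2) by simp
    next
      case False
      then have le: "F b b \<le> 0" for b using kerF by blast
      \<comment> \<open>Here every \<open>z b\<close> of positive weight lies in the kernel of
        \<open>B\<close>, so strictness comes from \<open>ker\<close>, applied at one weight that is
        nonzero because the weights sum to 1.\<close>
      have "\<exists>b\<in>Basis. c b \<noteq> 0" using c(2) by (metis sum.neutral zero_neq_one)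
      then obtain b where b: "b \<in> Basis" "c b \<noteq> 0" by blast
      have "z b \<noteq> 0" using z[of b] by auto
      then have "Z b \<noteq> 0" using b by (simp add: Zb)
      moreover have "X b = 0" using False by blast
      ultimately have "F b b < 0" using ker[of "Z b"] by (simp add: F_def X_def)
      then have "(\<Sum>b\<in>Basis. F b b) < (\<Sum>b\<in>(Basis :: (((real^'k^'k) \<times> real) \<times> real) set). 0)"
        using b le by (intro sum_strict_mono_ex1) auto
      then show False using sumF r(2) by simp
    qed
  qed
  have "closed ({0} \<times> {0..} :: ((real^'k^'k) \<times> real) set)" "convex ({0} \<times> {0..} :: ((real^'k^'k) \<times> real) set)"
    by (intro closed_Times convex_Times; simp)+
  then have "\<exists>a \<beta>. (\<forall>x\<in>W. a \<bullet> x < \<beta>) \<and> (\<forall>x\<in>{0} \<times> {0..}. a \<bullet> x > \<beta>)"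
    using \<open>compact W\<close> \<open>W \<noteq> {}\<close> disj
    by (intro separating_hyperplane_compact_closed) (simp_all add: W_def)
  then obtain a \<beta> where sepW: "\<And>x. x \<in> W \<Longrightarrow> a \<bullet> x < \<beta>" and sepT: "\<And>x. x \<in> {0} \<times> {0..} \<Longrightarrow> a \<bullet> x > \<beta>"
    by blast
  obtain M s where a: "a = (M, s)" by force
  have \<beta>: "\<beta> < 0" using sepT[of "(0,0)"] by (simp add: a)
  \<comment> \<open>For negative \<open>s\<close> the point \<open>(0, \<beta> / s)\<close> of the
    half-line would take exactly the value \<beta>, against strict separation.\<close>
  have s: "s \<ge> 0"
  proof (rule ccontr)
    assume "\<not> s \<ge> 0"
    then have "s < 0" by simp
    then have "\<beta> / s \<ge> 0" using \<beta> by (simp add: divide_nonpos_neg)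
    then show False using sepT[of "(0, \<beta> / s)"] \<open>s < 0\<close> by (simp add: a)
  qed
  have ineq: "A z \<bullet> ((M + transpose M) *v B z) + s * f z z < 0" if "z \<noteq> 0" for z
  proof -
    define y where "y = z /\<^sub>R norm z"
    have zy: "z = norm z *\<^sub>R y" and ny: "norm y = 1" using that by (auto simp: y_def)
    have "\<phi> y \<in> W" using ny unfolding W_def by (intro hull_inc imageI) simp
    then have "a \<bullet> \<phi> y < 0" using sepW \<beta> by fastforce
    moreover have "a \<bullet> \<phi> y = A y \<bullet> ((M + transpose M) *v B y) + s * f y y"
      by (simp add: a \<phi>_def inner_add_right inner_outer matrix_vector_mult_add_rdistrib
          dot_lmul_matrix[symmetric] inner_commute)
    ultimately have "(norm z)\<^sup>2 * (A y \<bullet> ((M + transpose M) *v B y) + s * f y y) < 0"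
      using that by (simp add: mult_pos_neg)
    also have "(norm z)\<^sup>2 * (A y \<bullet> ((M + transpose M) *v B y) + s * f y y)
        = A (norm z *\<^sub>R y) \<bullet> ((M + transpose M) *v B (norm z *\<^sub>R y)) + s * f (norm z *\<^sub>R y) (norm z *\<^sub>R y)"
      by (simp add: linear_cmul[OF A] linear_cmul[OF B] bilinear_lmul[OF f] bilinear_rmul[OF f]
          matrix_vector_mult_scaleR power2_eq_square algebra_simps)
    also have "norm z *\<^sub>R y = z" using zy by simp
    finally show ?thesis .
  qed
  show ?thesis
  proof (rule that[OF _ s ineq])
    show "transpose (M + transpose M) = M + transpose M"
      by (simp add: transpose_def vec_eq_iff)
  qed
qed

section \<open>Lyapunov matrices of Hurwitz matrices\<close>

text \<open>The case \<open>B = id\<close>, \<open>f = 0\<close> of \<open>kyp_lemma\<close>: the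
  frequency condition then says that \<open>P - s I\<close> has no imaginary eigenvalue, and a
  violation would give \<open>P\<close> an eigenvalue with real part \<open>s \<ge> 0\<close>. The
  sign of \<open>X\<close> remains open.\<close>

lemma lyapunov_solution_exists:
  fixes P :: "real^'k^'k"
  assumes P: "hurwitz P" and s: "s \<ge> 0"
  obtains X where "transpose X = X" "\<And>x. x \<noteq> 0 \<Longrightarrow> (P *v x - s *\<^sub>R x) \<bullet> (X *v x) < 0"
proof -
  have lin: "linear (\<lambda>x. P *v x - s *\<^sub>R x)" "linear (\<lambda>x::real^'k. x)"
    by (auto intro!: linearI simp: matrix_vector_right_distrib matrix_vector_mult_scaleR algebra_simps)
  have bil: "bilinear (\<lambda>(x::real^'k) (y::real^'k). 0 :: real)"
    by (auto simp: bilinear_def intro: linearI)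
  obtain X t where "transpose X = X" "\<And>x. x \<noteq> 0 \<Longrightarrow> (P *v x - s *\<^sub>R x) \<bullet> (X *v x) + t * 0 < 0"
  proof (rule kyp_lemma[OF lin bil])
    fix k z w assume z: "z \<noteq> 0" "P *v z - s *\<^sub>R z = - k *\<^sub>R w" "P *v w - s *\<^sub>R w = k *\<^sub>R z"
    have "is_eigenvalue P (Complex s k)"
      using z by (intro is_eigenvalue_real_pair[of _ z _ _ w]) (auto simp: algebra_simps)
    then show "0 + 0 < (0::real)" using P s by (auto simp: hurwitz_def)
  qed (auto simp: less_imp_neq)
  then show ?thesis using that by auto
qed

text \<open>Let \<open>m\<close> be the minimum of the quotient of the two forms, attained at
  \<open>v\<close>. Then \<open>v\<close> is in the radical of \<open>Y - m X\<close>; testing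
  against \<open>A v\<close> gives \<open>(A v) \<bullet> (Y v) = m ((A v) \<bullet> (X v))\<close>.
  Both products are negative, so \<open>m > 0\<close>.\<close>

lemma lyapunov_solutions_same_sign:
  fixes A X Y :: "real^'k^'k"
  assumes X: "transpose X = X" "\<And>x. x \<noteq> 0 \<Longrightarrow> x \<bullet> (X *v x) > 0" "\<And>x. x \<noteq> 0 \<Longrightarrow> (A *v x) \<bullet> (X *v x) < 0"
    and Y: "transpose Y = Y" "\<And>x. x \<noteq> 0 \<Longrightarrow> (A *v x) \<bullet> (Y *v x) < 0"
    and x: "x \<noteq> 0"
  shows "x \<bullet> (Y *v x) > 0"
proof -
  let ?q = "\<lambda>x. (x \<bullet> (Y *v x)) / (x \<bullet> (X *v x))"
  have "continuous_on (sphere 0 1) ?q"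
    by (intro continuous_intros bilinear_continuous_on_compose[OF _ _ bilinear_inner_mv])
      (metis X(2) dist_0_norm less_irrefl mem_sphere norm_zero zero_neq_one)
  moreover have "sphere 0 (1::real) \<noteq> ({} :: (real^'k) set)" by simp
  ultimately obtain v where v: "v \<in> sphere 0 1" and min: "\<And>z. z \<in> sphere 0 1 \<Longrightarrow> ?q v \<le> ?q z"
    using continuous_attains_inf[of "sphere 0 1" ?q] by (metis (no_types, lifting) compact_sphere)
  define m where "m = ?q v"
  have v0: "v \<noteq> 0" using v by auto
  define f where "f = (\<lambda>x y. x \<bullet> ((Y - m *\<^sub>R X) *v y))"
  have f_eq: "f x y = x \<bullet> (Y *v y) - m * (x \<bullet> (X *v y))" for x y
    by (simp add: f_def matrix_vector_mult_diff_rdistrib scaleR_mv inner_diff_right)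
  have psd: "f z z \<ge> 0" for z
  proof (cases "z = 0")
    case False
    then have "m \<le> ?q (z /\<^sub>R norm z)" unfolding m_def by (intro min) simp
    then have "m \<le> ?q z" using False by (simp add: matrix_vector_mult_scaleR)
    then show ?thesis using X(2)[OF False] by (simp add: f_eq divide_simps)
  qed (simp add: f_def)
  have "f v (A *v v) = 0"
  proof (rule psd_form_kernel[of f UNIV])
    show "bilinear f" unfolding f_def by (rule bilinear_inner_mv)
    show "f u v = f v u" for u v
      using inner_mv_symmetric[OF X(1), of u v] inner_mv_symmetric[OF Y(1), of u v] by (simp add: f_eq)
    show "f v v \<le> 0" using X(2)[OF v0] by (simp add: f_eq m_def)
  qed (use psd in auto)
  then have "(A *v v) \<bullet> (Y *v v) = m * ((A *v v) \<bullet> (X *v v))"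
    using inner_mv_symmetric[OF X(1), of v "A *v v"] inner_mv_symmetric[OF Y(1), of v "A *v v"]
    by (simp add: f_eq)
  then have "m > 0"
    using X(3)[OF v0] Y(2)[OF v0] by (metis mult_nonpos_nonpos less_le_not_le not_less)
  moreover have "x \<bullet> (Y *v x) \<ge> m * (x \<bullet> (X *v x))" using psd[of x] by (simp add: f_eq)
  ultimately show ?thesis using X(2)[OF x] by (meson less_le_trans mult_pos_pos)
qed

lemma shifted_mv: "(P - mat s) *v x = P *v x - s *\<^sub>R x" for x :: "real^'k"
  by (simp add: matrix_vector_mult_diff_rdistrib mat_mv)

text \<open>Continuation in the shift: the set of \<open>s \<ge> 0\<close> for which \<open>P - s I\<close> admits a positive
  definite Lyapunov matrix contains all large \<open>s\<close>, and its infimum cannot be positive.\<close>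

theorem lyapunov_positive:
  fixes P X :: "real^'k^'k"
  assumes P: "hurwitz P" and X: "transpose X = X" "\<And>x. x \<noteq> 0 \<Longrightarrow> (P *v x) \<bullet> (X *v x) < 0"
    and x: "x \<noteq> 0"
  shows "x \<bullet> (X *v x) > 0"
proof -
  define pos where "pos Y \<longleftrightarrow> transpose Y = Y \<and> (\<forall>x. x \<noteq> 0 \<longrightarrow> x \<bullet> (Y *v x) > 0)" for Y :: "real^'k^'k"
  define lyap where "lyap s Y \<longleftrightarrow> (\<forall>x. x \<noteq> 0 \<longrightarrow> ((P - mat s) *v x) \<bullet> (Y *v x) < 0)" for s Y
  define T where "T = {s. s \<ge> 0 \<and> (\<exists>Y. pos Y \<and> lyap s Y)}"
  obtain p where p: "p > 0" "\<And>z. \<bar>z \<bullet> (P *v z)\<bar> \<le> p * (norm z)\<^sup>2"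
    using quadratic_form_upper_bound[OF bilinear_inner_mv[of P]] by blast
  \<comment> \<open>Since \<open>z \<bullet> P z\<close> is at most \<open>p |z|^2\<close>, the
    shift \<open>p + 1\<close> makes the identity a Lyapunov matrix.\<close>
  have "lyap (p + 1) (mat 1)"
    unfolding lyap_def shifted_mv
  proof (intro allI impI)
    fix z :: "real^'k" assume "z \<noteq> 0"
    have "(P *v z) \<bullet> z \<le> p * (norm z)\<^sup>2" using p(2)[of z] by (simp add: inner_commute)
    moreover have "(P *v z - (p + 1) *\<^sub>R z) \<bullet> (mat 1 *v z) = (P *v z) \<bullet> z - p * (norm z)\<^sup>2 - (norm z)\<^sup>2"
      by (simp add: inner_diff_left power2_norm_eq_inner distrib_right)
    moreover have "0 < (norm z)\<^sup>2" using \<open>z \<noteq> 0\<close> by simp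
    ultimately show "(P *v z - (p + 1) *\<^sub>R z) \<bullet> (mat 1 *v z) < 0"
      by linarith
  qed
  moreover have "pos (mat 1)" by (simp add: pos_def)
  ultimately have "p + 1 \<in> T" using p(1) by (auto simp: T_def)
  then have T: "T \<noteq> {}" "bdd_below T" by (auto simp: T_def)
  define s where "s = Inf T"
  have s0: "s \<ge> 0" unfolding s_def using T by (intro cInf_greatest) (auto simp: T_def)
  \<comment> \<open>A solution at the infimum itself, of unknown sign so far. Its margin \<eta> and
    bound \<open>b\<close> keep it a solution for all shifts within \<open>\<eta> / b\<close> of
    \<open>s\<close>.\<close>
  obtain Y where Y: "transpose Y = Y" "\<And>x. x \<noteq> 0 \<Longrightarrow> (P *v x - s *\<^sub>R x) \<bullet> (Y *v x) < 0"
    using lyapunov_solution_exists[OF P s0] by metis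
  define f where "f = (\<lambda>x y. x \<bullet> ((- (transpose (P - mat s) ** Y)) *v y))"
  have f_eq: "f x y = - (((P - mat s) *v x) \<bullet> (Y *v y))" for x y
    using dot_lmul_matrix[of x "transpose (P - mat s)" "Y *v y"]
    by (simp add: f_def uminus_mv flip: matrix_vector_mul_assoc)
  have bilf: "bilinear f" unfolding f_def by (rule bilinear_inner_mv)
  obtain \<eta> where \<eta>: "\<eta> > 0" "\<And>z. \<eta> * (norm z)\<^sup>2 \<le> f z z"
    using quadratic_form_lower_bound[OF bilf] Y(2) by (auto simp: f_eq shifted_mv)
  obtain b where b: "b > 0" "\<And>z. \<bar>z \<bullet> (Y *v z)\<bar> \<le> b * (norm z)\<^sup>2"
    using quadratic_form_upper_bound[OF bilinear_inner_mv[of Y]] by blast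
  have near: "lyap t Y" if t: "\<bar>t - s\<bar> * b < \<eta>" for t
    unfolding lyap_def
  proof (intro allI impI)
    fix z :: "real^'k" assume z: "z \<noteq> 0"
    have "((P - mat t) *v z) \<bullet> (Y *v z) = - f z z + - ((t - s) * (z \<bullet> (Y *v z)))"
      unfolding f_eq shifted_mv by (simp add: inner_diff_left left_diff_distrib)
    also have "- ((t - s) * (z \<bullet> (Y *v z))) \<le> \<bar>t - s\<bar> * \<bar>z \<bullet> (Y *v z)\<bar>"
      by (metis abs_ge_minus_self abs_mult)
    also have "\<dots> \<le> \<bar>t - s\<bar> * (b * (norm z)\<^sup>2)" by (intro mult_left_mono b) auto
    finally have "((P - mat t) *v z) \<bullet> (Y *v z) \<le> - (\<eta> - \<bar>t - s\<bar> * b) * (norm z)\<^sup>2"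
      using \<eta>(2)[of z] by (simp add: algebra_simps)
    also have "\<dots> < 0" using t z by (intro mult_neg_pos) auto
    finally show "((P - mat t) *v z) \<bullet> (Y *v z) < 0" .
  qed
  \<comment> \<open>Some shift of \<open>T\<close> lies in the range where \<open>Y\<close> still
    works; comparison with the positive definite solution there makes \<open>Y\<close> positive
    definite.\<close>
  have "s < s + \<eta> / b" using \<eta> b by simp
  then obtain t where t: "t \<in> T" "t < s + \<eta> / b"
    using cInf_lessD[OF T(1), of "s + \<eta> / b"] unfolding s_def by blast
  have "s \<le> t" unfolding s_def using t T by (intro cInf_lower) auto
  then have "\<bar>t - s\<bar> * b < \<eta>" using t b by (simp add: field_simps)
  then have "lyap t Y" by (rule near)
  moreover obtain Z where "pos Z" "lyap t Z" using t by (auto simp: T_def)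
  ultimately have posY: "pos Y"
    using lyapunov_solutions_same_sign[of Z "P - mat t" Y] Y(1) by (auto simp: pos_def lyap_def)
  have "s = 0"
  proof (rule ccontr)
    assume "s \<noteq> 0"
    \<comment> \<open>If \<open>s\<close> were positive, \<open>Y\<close> would put a smaller shift
      into \<open>T\<close>. Half of the admissible distance keeps the inequality strict, and the
      maximum keeps \<open>t\<close> nonnegative.\<close>
    define t where "t = max 0 (s - \<eta> / (2 * b))"
    have "s - \<eta> / (2 * b) \<le> t" "t < s" using \<open>s \<noteq> 0\<close> s0 \<eta> b by (auto simp: t_def)
    then have "\<bar>t - s\<bar> \<le> \<eta> / (2 * b)" by simp
    then have "\<bar>t - s\<bar> * b \<le> \<eta> / 2" using b by (simp add: field_simps)
    then have "\<bar>t - s\<bar> * b < \<eta>" using \<eta> by simp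
    then have "t \<in> T" using near posY by (auto simp: T_def t_def)
    then show False using \<open>t < s\<close> T cInf_lower[of t T] by (simp add: s_def)
  qed
  then show ?thesis
    using lyapunov_solutions_same_sign[of Y P X] posY Y(2) X x by (auto simp: pos_def)
qed

section \<open>The frequency condition\<close>

text \<open>The quadratic form \<open>\<bar>i \<omega> R x - x\<bar>\<^sup>2 - g \<bar>x\<bar>\<^sup>2\<close> of the complex vector \<open>x = a + i b\<close>, in real coordinates.\<close>

definition freq_form :: "real^'k^'k \<Rightarrow> real \<Rightarrow> real \<Rightarrow> (real^'k) \<times> (real^'k) \<Rightarrow> (real^'k) \<times> (real^'k) \<Rightarrow> real" where
  "freq_form R g \<omega> u v =
     (- \<omega> *\<^sub>R (R *v snd u) - fst u) \<bullet> (- \<omega> *\<^sub>R (R *v snd v) - fst v) +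
     (\<omega> *\<^sub>R (R *v fst u) - snd u) \<bullet> (\<omega> *\<^sub>R (R *v fst v) - snd v) - g * (u \<bullet> v)"

lemma bilinear_freq_form: "bilinear (freq_form R g \<omega>)"
  unfolding freq_form_def[abs_def] by (intro linear_simple_intros)

lemma freq_form_commute: "freq_form R g \<omega> u v = freq_form R g \<omega> v u"
  by (simp add: freq_form_def inner_commute)

lemma norm_scaleR_diff: "(k *\<^sub>R y - x) \<bullet> (k *\<^sub>R y - x) = k\<^sup>2 * (norm y)\<^sup>2 - 2 * k * (x \<bullet> y) + (norm x)\<^sup>2"
  for x y :: "'a::real_inner"
  unfolding power2_norm_eq_inner by (simp add: inner_simps power2_eq_square inner_commute)

lemma freq_form_quadratic: "freq_form R g \<omega> u u = \<omega>\<^sup>2 * ((norm (R *v fst u))\<^sup>2 + (norm (R *v snd u))\<^sup>2)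
    + 2 * \<omega> * (fst u \<bullet> (R *v snd u) - snd u \<bullet> (R *v fst u)) + (1 - g) * (norm u)\<^sup>2"
  unfolding freq_form_def norm_scaleR_diff
  by (simp add: norm_Pair[of "fst u" "snd u", simplified] power2_norm_eq_inner[of u] inner_prod_def
      flip: power2_norm_eq_inner) (simp add: algebra_simps)

text \<open>Injectivity of \<open>R\<close> bounds the quadratic term in \<omega> below by
  \<open>a \<omega>^2 |u|^2\<close>, which beats the linear term, bounded through \<open>r\<close>,
  and the constant one. The threshold is at least 1 so that \<open>|g|\<close> can be absorbed into
  \<open>\<omega> |g|\<close>.\<close>

lemma freq_form_eventually_pos:
  fixes P R :: "real^'k^'k"
  assumes R: "P ** R = mat 1"
  obtains \<Omega> where "\<And>\<omega> u. \<omega> > \<Omega> \<Longrightarrow> u \<noteq> 0 \<Longrightarrow> freq_form R g \<omega> u u > 0"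
proof -
  have inj: "R *v x \<noteq> 0" if "x \<noteq> 0" for x
  proof
    assume "R *v x = 0"
    then have "P *v (R *v x) = 0" by simp
    then show False using that R by (simp add: matrix_vector_mul_assoc)
  qed
  have bil: "bilinear (\<lambda>u v. (R *v fst u) \<bullet> (R *v fst v) + (R *v snd u) \<bullet> (R *v snd v))"
    by (intro linear_simple_intros)
  obtain a where a: "a > 0" "\<And>u. a * (norm u)\<^sup>2 \<le> (norm (R *v fst u))\<^sup>2 + (norm (R *v snd u))\<^sup>2"
  proof (rule quadratic_form_lower_bound[OF bil])
    fix u :: "(real^'k) \<times> (real^'k)" assume "u \<noteq> 0"
    then have "fst u \<noteq> 0 \<or> snd u \<noteq> 0" by (auto simp: prod_eq_iff)
    then show "0 < (R *v fst u) \<bullet> (R *v fst u) + (R *v snd u) \<bullet> (R *v snd u)"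
      using inj[of "fst u"] inj[of "snd u"]
      by (metis add_nonneg_pos add_pos_nonneg inner_ge_zero inner_gt_zero_iff)
  qed (auto simp: power2_norm_eq_inner)
  have bil2: "bilinear (\<lambda>u v. fst u \<bullet> (R *v snd v) - snd u \<bullet> (R *v fst v))"
    by (intro linear_simple_intros)
  obtain r where r: "r > 0" "\<And>u. \<bar>fst u \<bullet> (R *v snd u) - snd u \<bullet> (R *v fst u)\<bar> \<le> r * (norm u)\<^sup>2"
    using quadratic_form_upper_bound[OF bil2] by blast
  show ?thesis
  proof
    fix \<omega> :: real and u :: "(real^'k) \<times> (real^'k)"
    assume \<omega>: "\<omega> > max 1 ((2 * r + \<bar>g\<bar>) / a)" and u: "u \<noteq> 0"
    then have big: "\<omega> > 1" "\<omega> * a > 2 * r + \<bar>g\<bar>" using a by (auto simp: field_simps)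
    have "\<omega> * (2 * r + \<bar>g\<bar>) < \<omega> * (\<omega> * a)" using big by (intro mult_strict_left_mono) auto
    moreover have "\<bar>g\<bar> \<le> \<omega> * \<bar>g\<bar>" using big by (simp add: mult_le_cancel_right1)
    ultimately have "\<omega>\<^sup>2 * a - 2 * \<omega> * r + (1 - g) > 0" by (simp add: power2_eq_square algebra_simps)
    then have "0 < (\<omega>\<^sup>2 * a - 2 * \<omega> * r + (1 - g)) * (norm u)\<^sup>2" using u by simp
    also have "\<dots> = \<omega>\<^sup>2 * (a * (norm u)\<^sup>2) + 2 * \<omega> * (- (r * (norm u)\<^sup>2)) + (1 - g) * (norm u)\<^sup>2"
      by (simp add: algebra_simps)
    also have "\<dots> \<le> freq_form R g \<omega> u u"
      unfolding freq_form_quadratic using a(2)[of u] r(2)[of u] big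
      by (intro add_mono mult_left_mono order_refl) auto
    finally show "freq_form R g \<omega> u u > 0" .
  qed
qed

text \<open>Put \<open>x = a + i b\<close> and \<open>e = i \<omega> R x - x\<close>. Singularity
  reads \<open>- e - i \<omega> R^T e = g x\<close>. With \<open>y = R^T e / c\<close>, the
  definition of \<open>e\<close> multiplied by \<open>P\<close> becomes
  \<open>P x + c P P^T y = i \<omega> x\<close>, and singularity divided by \<open>c\<close> becomes
  \<open>- (c + \<epsilon>) x - P^T y = i \<omega> y\<close>: the two rows of the eigenvector
  equation of \<open>N\<close>. This is why \<open>g = c (c + \<epsilon>)\<close>.\<close>

lemma freq_form_singular_eigenvalue:
  fixes P R :: "real^'k^'k"
  assumes R: "P ** R = mat 1" and c: "c = 1 - \<alpha> / \<beta>" "c \<noteq> 0" and g: "g = c * (c + \<epsilon>)"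
    and sing: "\<And>v. freq_form R g \<omega> u v = 0" and u: "u \<noteq> 0"
  shows "is_eigenvalue (N_mat P \<alpha> \<beta> \<epsilon>) (Complex 0 \<omega>)"
proof -
  define a b where "a = fst u" "b = snd u"
  define e1 e2 where "e1 = - \<omega> *\<^sub>R (R *v b) - a" "e2 = \<omega> *\<^sub>R (R *v a) - b"
  note defs = a_b_def e1_e2_def
  have adj: "x \<bullet> (R *v y) = (transpose R *v x) \<bullet> y" for x y
    by (metis dot_lmul_matrix transpose_matrix_vector)
  have eq1: "- e1 + \<omega> *\<^sub>R (transpose R *v e2) - g *\<^sub>R a = 0"
  proof -
    have "(- e1 + \<omega> *\<^sub>R (transpose R *v e2) - g *\<^sub>R a) \<bullet> x = 0" for x
      using sing[of "(x, 0)"] adj[of e2 x] unfolding freq_form_def defs[symmetric]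
      by (simp add: inner_prod_def inner_simps flip: defs)
    then show ?thesis by (metis inner_eq_zero_iff)
  qed
  have eq2: "- \<omega> *\<^sub>R (transpose R *v e1) - e2 - g *\<^sub>R b = 0"
  proof -
    have "(- \<omega> *\<^sub>R (transpose R *v e1) - e2 - g *\<^sub>R b) \<bullet> x = 0" for x
      using sing[of "(0, x)"] adj[of e1 x] unfolding freq_form_def defs[symmetric]
      by (simp add: inner_prod_def inner_simps flip: defs)
    then show ?thesis by (metis inner_eq_zero_iff)
  qed
  have PR: "P *v (R *v x) = x" and PRT: "transpose P *v (transpose R *v x) = x" for x
  proof -
    show "P *v (R *v x) = x" using R by (simp add: matrix_vector_mul_assoc)
    have "transpose P ** transpose R = mat 1"
      using R matrix_left_right_inverse[of P R] by (metis matrix_transpose_mul transpose_mat)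
    then show "transpose P *v (transpose R *v x) = x" by (simp only: matrix_vector_mul_assoc matrix_vector_mul_lid)
  qed
  define y1 y2 where "y1 = (1 / c) *\<^sub>R (transpose R *v e1)" "y2 = (1 / c) *\<^sub>R (transpose R *v e2)"
  have Pe: "P *v a + P *v e1 = - \<omega> *\<^sub>R b" "P *v b + P *v e2 = \<omega> *\<^sub>R a"
    using PR[of a] PR[of b]
    by (simp_all add: e1_e2_def matrix_vector_mult_diff_distrib matrix_vector_mult_scaleR
        matrix_vector_right_distrib[symmetric] algebra_simps flip: scaleR_minus_left)
  have N: "N_mat P \<alpha> \<beta> \<epsilon> *v vjoin x (y::real^'k) = vjoin (P *v x + c *\<^sub>R (P *v (transpose P *v y)))
      (- (c + \<epsilon>) *\<^sub>R x - transpose P *v y)" for x y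
    by (simp add: N_mat_def block_vjoin scaleR_mv uminus_mv mat_mv c algebra_simps
        flip: matrix_vector_mul_assoc)
  have E1: "e1 = \<omega> *\<^sub>R (transpose R *v e2) - g *\<^sub>R a" using eq1 by (simp add: algebra_simps)
  have E2: "e2 = - \<omega> *\<^sub>R (transpose R *v e1) - g *\<^sub>R b" using eq2 by (simp add: algebra_simps)
  have low: "- (c + \<epsilon>) *\<^sub>R a - transpose P *v y1 = - \<omega> *\<^sub>R y2"
    "- (c + \<epsilon>) *\<^sub>R b - transpose P *v y2 = \<omega> *\<^sub>R y1"
  proof -
    have "transpose P *v y1 = (1 / c) *\<^sub>R e1" "transpose P *v y2 = (1 / c) *\<^sub>R e2"
      by (simp_all add: y1_y2_def matrix_vector_mult_scaleR PRT del: transpose_matrix_vector)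
    moreover have "(1 / c) *\<^sub>R e1 = \<omega> *\<^sub>R y2 - (c + \<epsilon>) *\<^sub>R a"
      "(1 / c) *\<^sub>R e2 = - \<omega> *\<^sub>R y1 - (c + \<epsilon>) *\<^sub>R b"
      by (subst E1, use c(2) in \<open>simp add: y1_y2_def g algebra_simps\<close>)
        (subst E2, use c(2) in \<open>simp add: y1_y2_def g algebra_simps\<close>)
    ultimately have "transpose P *v y1 = \<omega> *\<^sub>R y2 - (c + \<epsilon>) *\<^sub>R a"
      "transpose P *v y2 = - \<omega> *\<^sub>R y1 - (c + \<epsilon>) *\<^sub>R b" by (simp_all only:)
    then show "- (c + \<epsilon>) *\<^sub>R a - transpose P *v y1 = - \<omega> *\<^sub>R y2"
      "- (c + \<epsilon>) *\<^sub>R b - transpose P *v y2 = \<omega> *\<^sub>R y1"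
      by (simp_all add: scaleR_add_left[symmetric] del: transpose_matrix_vector)
  qed
  have up: "P *v a + c *\<^sub>R (P *v (transpose P *v y1)) = - \<omega> *\<^sub>R b"
    "P *v b + c *\<^sub>R (P *v (transpose P *v y2)) = \<omega> *\<^sub>R a"
    using Pe c(2) by (simp_all add: y1_y2_def matrix_vector_mult_scaleR PRT del: transpose_matrix_vector)
  show ?thesis
  proof (rule is_eigenvalue_real_pair[of _ "vjoin a y1" _ _ "vjoin b y2"])
    show "N_mat P \<alpha> \<beta> \<epsilon> *v vjoin a y1 = 0 *\<^sub>R vjoin a y1 - \<omega> *\<^sub>R vjoin b y2"
      unfolding N low up by (simp add: vjoin_scaleR vjoin_uminus)
    show "N_mat P \<alpha> \<beta> \<epsilon> *v vjoin b y2 = \<omega> *\<^sub>R vjoin a y1 + 0 *\<^sub>R vjoin b y2"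
      unfolding N low up by (simp add: vjoin_scaleR)
    have "a \<noteq> 0 \<or> b \<noteq> 0" using u by (auto simp: a_b_def prod_eq_iff)
    then show "vjoin a y1 \<noteq> 0 \<or> vjoin b y2 \<noteq> 0" by (metis vfst_vjoin vjoin_0)
  qed
qed

text \<open>At the largest frequency where the form fails to be positive definite it is positive
  semidefinite and singular, and \<open>N\<close> would have an imaginary eigenvalue.\<close>

theorem freq_form_pos:
  fixes P R :: "real^'k^'k"
  assumes R: "P ** R = mat 1" and c: "c = 1 - \<alpha> / \<beta>" "c \<noteq> 0" and g: "g = c * (c + \<epsilon>)"
    and N: "\<And>z. Re z = 0 \<Longrightarrow> \<not> is_eigenvalue (N_mat P \<alpha> \<beta> \<epsilon>) z" and u: "u \<noteq> 0"
  shows "freq_form R g \<omega> u u > 0"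
proof (rule ccontr)
  assume neg: "\<not> freq_form R g \<omega> u u > 0"
  obtain \<Omega> where \<Omega>: "\<And>\<omega> u. \<omega> > \<Omega> \<Longrightarrow> u \<noteq> 0 \<Longrightarrow> freq_form R g \<omega> u u > 0"
    using freq_form_eventually_pos[OF R] by blast
  have bil: "bilinear (freq_form R g \<omega>)" for \<omega> by (rule bilinear_freq_form)
  have normalize: "freq_form R g \<omega> (v /\<^sub>R norm v) (v /\<^sub>R norm v) = freq_form R g \<omega> v v / (norm v)\<^sup>2" for \<omega> v
    by (simp add: bilinear_lmul[OF bil] bilinear_rmul[OF bil] power2_eq_square divide_simps)
  \<comment> \<open>The frequencies, from \<omega> on, and unit vectors where positivity fails. The
    upper bound \<Omega> makes this set compact, so a largest such frequency exists.\<close>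
  define T where "T = {\<omega>..\<Omega>} \<times> sphere 0 1 \<inter> {x. freq_form R g (fst x) (snd x) (snd x) \<le> 0}"
  have "continuous_on UNIV (\<lambda>x. freq_form R g (fst x) (snd x) (snd x))"
    unfolding freq_form_def
    by (intro continuous_intros linear_continuous_on_compose[OF _ matrix_vector_mul_linear])
  then have "closed {x. freq_form R g (fst x) (snd x) (snd x) \<le> 0}"
    by (intro closed_Collect_le continuous_intros)
  then have "compact T" unfolding T_def by (intro compact_Int_closed compact_Times) auto
  moreover have "\<omega> \<le> \<Omega>" using neg \<Omega>[of \<omega> u] u by (metis not_less)
  then have "(\<omega>, u /\<^sub>R norm u) \<in> T"
    using neg u by (auto simp: T_def normalize divide_nonpos_pos not_less)
  ultimately obtain x where x: "x \<in> T" and max: "\<And>y. y \<in> T \<Longrightarrow> fst y \<le> fst x"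
    using continuous_attains_sup[of T fst] continuous_on_fst[OF continuous_on_id, of T] by blast
  define s v where "s = fst x" "v = snd x"
  have v: "norm v = 1" "freq_form R g s v v \<le> 0" and s: "\<omega> \<le> s"
    using x by (auto simp: T_def s_v_def)
  have above: "freq_form R g t w w \<ge> 0" if t: "t > s" for t w
  proof (cases "w = 0")
    case False
    show ?thesis
    proof (rule ccontr)
      assume neg: "\<not> freq_form R g t w w \<ge> 0"
      have "t \<le> \<Omega>" using neg \<Omega>[of t w] False by (metis less_imp_le not_less)
      with neg have "(t, w /\<^sub>R norm w) \<in> T"
        using False t s by (auto simp: T_def normalize divide_nonpos_pos not_less)
      then show False using max[of "(t, w /\<^sub>R norm w)"] t by (simp add: s_v_def)
    qed
  qed (simp add: bilinear_lzero[OF bil])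
  have psd: "freq_form R g s w w \<ge> 0" for w
  proof (rule tendsto_lowerbound)
    show "((\<lambda>t. freq_form R g t w w) \<longlongrightarrow> freq_form R g s w w) (at_right s)"
      unfolding freq_form_def by (intro tendsto_intros)
    show "\<forall>\<^sub>F t in at_right s. 0 \<le> freq_form R g t w w"
      using above by (auto simp: eventually_at_filter)
  qed simp
  have "freq_form R g s v w = 0" for w
    by (rule psd_form_kernel[OF bil freq_form_commute subspace_UNIV psd UNIV_I v(2) UNIV_I])
  moreover have "v \<noteq> 0" using v by auto
  ultimately have "is_eigenvalue (N_mat P \<alpha> \<beta> \<epsilon>) (Complex 0 s)"
    by (intro freq_form_singular_eigenvalue[OF R c g])
  then show False using N by simp
qed

section \<open>The linear matrix inequality\<close>

text \<open>No eigenvalues are needed: the form of \<open>A\<close> at \<open>c x - A x\<close> is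
  nonnegative, and expanding it with both bounds yields
  \<open>c (c^2 |x|^2 - |A x|^2) \<ge> 0\<close>.\<close>

lemma norm_le_psd_bound:
  fixes A :: "real^'k^'k"
  assumes sym: "transpose A = A" and bnd: "\<And>z. 0 \<le> z \<bullet> (A *v z)" "\<And>z. z \<bullet> (A *v z) \<le> c * (norm z)\<^sup>2"
    and c: "c > 0"
  shows "(norm (A *v x))\<^sup>2 \<le> c\<^sup>2 * (norm x)\<^sup>2"
proof -
  define y where "y = A *v x"
  have "0 \<le> (c *\<^sub>R x - y) \<bullet> (A *v (c *\<^sub>R x - y))" by (rule bnd)
  also have "\<dots> = c\<^sup>2 * (x \<bullet> (A *v x)) - 2 * c * (norm y)\<^sup>2 + y \<bullet> (A *v y)"
    using inner_mv_symmetric[OF sym, of x y]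
    unfolding power2_norm_eq_inner
    by (simp add: matrix_vector_mult_diff_distrib matrix_vector_mult_scaleR inner_simps
        power2_eq_square algebra_simps flip: y_def)
  also have "\<dots> \<le> c\<^sup>2 * (c * (norm x)\<^sup>2) - 2 * c * (norm y)\<^sup>2 + c * (norm y)\<^sup>2"
    by (intro add_mono diff_mono mult_left_mono bnd order_refl) auto
  also have "\<dots> = c * (c\<^sup>2 * (norm x)\<^sup>2 - (norm y)\<^sup>2)" by (simp add: algebra_simps power2_eq_square)
  finally show ?thesis using c by (simp add: y_def zero_le_mult_iff)
qed

text \<open>An instance of the S-procedure: every admissible \<open>S\<close> gives a pair
  \<open>(x, w)\<close>, \<open>w = S x / \<beta>\<close>, with
  \<open>f (x, w) (x, w) \<ge> 0\<close>, so the term with the multiplier \<open>s\<close> may be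
  dropped. As the inequality for pairs does not mention \<open>S\<close>, both \<open>X\<close> and
  the margin hold for all \<open>S\<close> at once.\<close>

theorem contraction_lmi:
  fixes P :: "real^'k^'k"
  assumes P: "hurwitz P" and \<alpha>: "0 < \<alpha>" "\<alpha> < \<beta>" and \<epsilon>: "\<epsilon> > 0"
    and N: "\<And>z. Re z = 0 \<Longrightarrow> \<not> is_eigenvalue (N_mat P \<alpha> \<beta> \<epsilon>) z"
  obtains X \<eta> where "transpose X = X" "\<And>x. x \<noteq> 0 \<Longrightarrow> x \<bullet> (X *v x) > 0" "\<eta> > 0"
    "\<And>S x. transpose S = S \<Longrightarrow> (\<And>z. \<alpha> * (norm z)\<^sup>2 \<le> z \<bullet> (S *v z)) \<Longrightarrow>
      (\<And>z. z \<bullet> (S *v z) \<le> \<beta> * (norm z)\<^sup>2) \<Longrightarrow> x \<bullet> (X *v (P *v (S *v x))) \<le> - \<eta> * (norm x)\<^sup>2"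
proof -
  define c where "c = 1 - \<alpha> / \<beta>"
  have \<beta>: "\<beta> > 0" using \<alpha> by simp
  have c: "c > 0" using \<alpha> by (simp add: c_def)
  obtain R where R: "P ** R = mat 1" "R ** P = mat 1" using hurwitz_invertible[OF P] .
  define f where "f = (\<lambda>u v :: (real^'k) \<times> (real^'k).
    c\<^sup>2 * (fst u \<bullet> fst v) - (snd u - fst u) \<bullet> (snd v - fst v))"
  have bil: "bilinear f" unfolding f_def by (intro linear_simple_intros)
  have lin: "linear (\<lambda>u. P *v snd u)" "linear (\<lambda>u :: (real^'k) \<times> (real^'k). fst u)"
    by (intro linear_simple_intros)+
  obtain X s where X: "transpose X = X" and s: "s \<ge> 0"
    and lmi: "\<And>u. u \<noteq> 0 \<Longrightarrow> (P *v snd u) \<bullet> (X *v fst u) + s * f u u < 0"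
  proof (rule kyp_lemma[OF lin bil])
    fix u :: "(real^'k) \<times> (real^'k)" assume "fst u = 0" "u \<noteq> 0"
    then show "f u u < 0" by (auto simp: f_def prod_eq_iff)
  next
    fix k and u v :: "(real^'k) \<times> (real^'k)"
    assume u: "fst u \<noteq> 0" and eq: "P *v snd u = - k *\<^sub>R fst v" "P *v snd v = k *\<^sub>R fst u"
    have RP: "R *v (P *v x) = x" for x using R(2) by (simp add: matrix_vector_mul_assoc)
    have w: "snd u = - k *\<^sub>R (R *v fst v)" "snd v = k *\<^sub>R (R *v fst u)"
      using arg_cong[OF eq(1), of "(*v) R"] arg_cong[OF eq(2), of "(*v) R"]
      by (simp_all add: RP matrix_vector_mult_scaleR flip: scaleR_minus_left)
    \<comment> \<open>The frequency relation forces \<open>w = i k R x\<close>, so \<open>f\<close>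
      becomes minus the frequency form with an extra \<open>- c \<epsilon> |x|^2\<close>, which
      comes from replacing \<open>c^2\<close> by \<open>c (c + \<epsilon>)\<close>.\<close>
    have "freq_form R (c * (c + \<epsilon>)) k (fst u, fst v) (fst u, fst v) > 0"
      using u c by (intro freq_form_pos[OF R(1) c_def _ refl N]) (auto simp: prod_eq_iff)
    moreover have "f u u + f v v = - freq_form R (c * (c + \<epsilon>)) k (fst u, fst v) (fst u, fst v)
        - c * \<epsilon> * ((norm (fst u))\<^sup>2 + (norm (fst v))\<^sup>2)"
      unfolding f_def freq_form_def w power2_norm_eq_inner
      by (simp add: inner_prod_def algebra_simps power2_eq_square)
    moreover have "c * \<epsilon> * ((norm (fst u))\<^sup>2 + (norm (fst v))\<^sup>2) \<ge> 0" using c \<epsilon> by simp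
    ultimately show "f u u + f v v < 0" by simp
  qed (use that in blast)
  \<comment> \<open>The choice \<open>w = x\<close>, corresponding to \<open>S = \<beta> I\<close>,
    reduces the inequality to the Lyapunov inequality for \<open>P\<close>.\<close>
  have pos: "x \<bullet> (X *v x) > 0" if x: "x \<noteq> 0" for x
  proof (rule lyapunov_positive[OF P X _ x])
    fix x :: "real^'k" assume "x \<noteq> 0"
    then have "(P *v x) \<bullet> (X *v x) + s * (c\<^sup>2 * (x \<bullet> x)) < 0"
      using lmi[of "(x, x)"] by (simp add: f_def prod_eq_iff)
    moreover have "s * (c\<^sup>2 * (x \<bullet> x)) \<ge> 0" using s by simp
    ultimately show "(P *v x) \<bullet> (X *v x) < 0" by linarith
  qed
  define g where "g = (\<lambda>u v. - 1 * ((P *v snd u) \<bullet> (X *v fst v) + s * f u v))"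
  have "bilinear g" unfolding g_def by (intro linear_simple_intros bil)
  then obtain \<eta> where \<eta>: "\<eta> > 0" "\<And>u. \<eta> * (norm u)\<^sup>2 \<le> g u u"
  proof (rule quadratic_form_lower_bound)
    fix u :: "(real^'k) \<times> (real^'k)" assume "u \<noteq> 0"
    then show "g u u > 0" using lmi[of u] by (simp add: g_def)
  qed (rule that)
  show ?thesis
  proof (rule that[OF X pos])
    show "\<beta> * \<eta> > 0" using \<beta> \<eta> by simp
    fix S :: "real^'k^'k" and x assume S: "transpose S = S" "\<And>z. \<alpha> * (norm z)\<^sup>2 \<le> z \<bullet> (S *v z)" "\<And>z. z \<bullet> (S *v z) \<le> \<beta> * (norm z)\<^sup>2"
    define w where "w = (1 / \<beta>) *\<^sub>R (S *v x)"
    \<comment> \<open>The spectrum of \<open>I - S / \<beta>\<close> lies between 0 and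
      \<open>c = 1 - \<alpha> / \<beta>\<close>, which is the origin of \<open>c\<close>.\<close>
    define \<Delta> where "\<Delta> = mat 1 - (1 / \<beta>) *\<^sub>R S"
    have \<Delta>z: "\<Delta> *v z = z - (1 / \<beta>) *\<^sub>R (S *v z)" for z
      by (simp add: \<Delta>_def matrix_vector_mult_diff_rdistrib scaleR_mv)
    have "transpose \<Delta> = \<Delta>"
      using S(1) by (simp add: \<Delta>_def transpose_def vec_eq_iff mat_def)
    moreover have "0 \<le> z \<bullet> (\<Delta> *v z)" "z \<bullet> (\<Delta> *v z) \<le> c * (norm z)\<^sup>2" for z
      using S(2)[of z] S(3)[of z] \<beta>
      by (simp_all add: \<Delta>z inner_diff_right c_def field_simps flip: power2_norm_eq_inner)
    ultimately have "(norm (\<Delta> *v x))\<^sup>2 \<le> c\<^sup>2 * (norm x)\<^sup>2"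
      using c by (intro norm_le_psd_bound)
    then have "f (x, w) (x, w) \<ge> 0"
      by (simp add: f_def \<Delta>z w_def norm_minus_commute flip: power2_norm_eq_inner)
    then have "0 \<le> s * f (x, w) (x, w)" using s by simp
    moreover have "\<eta> * (norm x)\<^sup>2 \<le> \<eta> * (norm (x, w))\<^sup>2" using \<eta>(1) by (simp add: norm_Pair)
    ultimately have "\<eta> * (norm x)\<^sup>2 \<le> - ((P *v w) \<bullet> (X *v x))"
      using \<eta>(2)[of "(x, w)"] by (simp add: g_def)
    also have "(P *v w) \<bullet> (X *v x) = (1 / \<beta>) * (x \<bullet> (X *v (P *v (S *v x))))"
      using inner_mv_symmetric[OF X, of "P *v (S *v x)" x] by (simp add: w_def matrix_vector_mult_scaleR)
    finally show "x \<bullet> (X *v (P *v (S *v x))) \<le> - (\<beta> * \<eta>) * (norm x)\<^sup>2"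
      using \<beta> by (simp add: field_simps)
  qed
qed

section \<open>Contraction in a constant metric\<close>

lemma psd_form_Cauchy_Schwarz:
  fixes X :: "real^'k^'k"
  assumes X: "transpose X = X" "\<And>x. x \<noteq> 0 \<Longrightarrow> x \<bullet> (X *v x) > 0"
  shows "u \<bullet> (X *v v) \<le> sqrt (u \<bullet> (X *v u)) * sqrt (v \<bullet> (X *v v))"
proof (cases "v = 0")
  case False
  define a b d where "a = u \<bullet> (X *v u)" "b = v \<bullet> (X *v v)" "d = u \<bullet> (X *v v)"
  note defs = a_b_d_def
  have b: "b > 0" using X(2)[OF False] by (simp add: defs)
  have "0 \<le> (b *\<^sub>R u - d *\<^sub>R v) \<bullet> (X *v (b *\<^sub>R u - d *\<^sub>R v))"
    using X(2)[of "b *\<^sub>R u - d *\<^sub>R v"] by (cases "b *\<^sub>R u - d *\<^sub>R v = 0") auto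
  also have "\<dots> = b * (b * a - d\<^sup>2)"
    using inner_mv_symmetric[OF X(1), of v u]
    by (simp add: matrix_vector_mult_diff_distrib matrix_vector_mult_scaleR inner_simps
        power2_eq_square algebra_simps flip: defs)
  finally have "d\<^sup>2 \<le> a * b" using b by (simp add: zero_le_mult_iff mult.commute)
  then have "\<bar>d\<bar> \<le> sqrt (a * b)" by (simp add: real_le_rsqrt)
  then show ?thesis by (simp add: real_sqrt_mult flip: defs)
qed simp

text \<open>The straight segment attains the value. For any other curve, Cauchy-Schwarz bounds the
  \<open>X\<close>-product of its velocity with \<open>y - x\<close> by the speed times the length
  of \<open>y - x\<close>; integration gives the lower bound.\<close>

lemma riem_dist_const:
  fixes X :: "real^'k^'k"
  assumes X: "transpose X = X" "\<And>x. x \<noteq> 0 \<Longrightarrow> x \<bullet> (X *v x) > 0"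
  shows "riem_dist (\<lambda>x t. X) t x y = sqrt ((y - x) \<bullet> (X *v (y - x)))"
  unfolding riem_dist_def
proof (rule cInf_eq_minimum)
  let ?e = "y - x"
  let ?N = "\<lambda>v. sqrt (v \<bullet> (X *v v))"
  show "?N ?e \<in> {L. \<exists>c c'. c 0 = x \<and> c 1 = y \<and> continuous_on {0..1} c' \<and>
     (\<forall>s\<in>{0..1}. (c has_vector_derivative c' s) (at s within {0..1})) \<and>
     ((\<lambda>s. sqrt (c' s \<bullet> (X *v c' s))) has_integral L) {0..1}}"
  proof (intro CollectI exI conjI)
    show "\<forall>s\<in>{0..1}. ((\<lambda>s. x + s *\<^sub>R ?e) has_vector_derivative ?e) (at s within {0..1})"
      by (auto intro!: derivative_eq_intros)
    show "((\<lambda>s. ?N ?e) has_integral ?N ?e) {0..1::real}"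
      using has_integral_const_real[of "?N ?e" 0 1] by simp
  qed auto
  fix L assume "L \<in> {L. \<exists>c c'. c 0 = x \<and> c 1 = y \<and> continuous_on {0..1} c' \<and>
     (\<forall>s\<in>{0..1}. (c has_vector_derivative c' s) (at s within {0..1})) \<and>
     ((\<lambda>s. sqrt (c' s \<bullet> (X *v c' s))) has_integral L) {0..1}}"
  then obtain c c' where c: "c 0 = x" "c 1 = y"
    and deriv: "\<And>s. s \<in> {0..1} \<Longrightarrow> (c has_vector_derivative c' s) (at s within {0..1})"
    and L: "((\<lambda>s. ?N (c' s)) has_integral L) {0..1}" by blast
  have X0: "v \<bullet> (X *v v) \<ge> 0" for v using X(2)[of v] by (cases "v = 0") auto
  show "?N ?e \<le> L"
  proof (cases "?e = 0")
    case True
    then show ?thesis using has_integral_nonneg[OF L] X0 by simp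
  next
    case False
    then have pos: "?N ?e > 0" using X(2) by simp
    have blin: "bounded_linear (\<lambda>v. ?e \<bullet> (X *v v))"
      using bilinear_inner_mv[of X] by (auto simp: bilinear_def linear_conv_bounded_linear)
    have "((\<lambda>s. ?e \<bullet> (X *v c' s)) has_integral (?e \<bullet> (X *v c 1) - ?e \<bullet> (X *v c 0))) {0..1}"
      using deriv by (intro fundamental_theorem_of_calculus bounded_linear.has_vector_derivative[OF blin]) auto
    moreover have "((\<lambda>s. ?N ?e * ?N (c' s)) has_integral ?N ?e * L) {0..1}"
      using L by (rule has_integral_mult_right)
    ultimately have "?e \<bullet> (X *v c 1) - ?e \<bullet> (X *v c 0) \<le> ?N ?e * L"
      by (rule has_integral_le) (rule psd_form_Cauchy_Schwarz[OF X])
    moreover have "?e \<bullet> (X *v c 1) - ?e \<bullet> (X *v c 0) = ?N ?e * ?N ?e"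
      using X0[of ?e] by (simp add: c inner_diff_right matrix_vector_mult_diff_distrib)
    ultimately have "?N ?e * ?N ?e \<le> ?N ?e * L" by (simp only:)
    then show ?thesis using pos by (rule mult_left_le_imp_le)
  qed
qed

text \<open>Decay is available only below the level \<open>R\<close>, since the vector field
  contracts only inside the ball. At a first time with \<open>g u \<ge> R\<close>, the mean value
  theorem would produce an earlier positive slope, although all earlier slopes are nonpositive.
  Hence the level is never reached.\<close>

lemma decay_while_below:
  fixes g :: "real \<Rightarrow> real"
  assumes T: "0 \<le> T" and g0: "g 0 < R" and nonneg: "\<And>t. 0 \<le> g t" and k: "k \<ge> 0"
    and deriv: "\<And>t. t \<in> {0..T} \<Longrightarrow> (g has_real_derivative g' t) (at t within {0..T})"
    and decay: "\<And>t. t \<in> {0..T} \<Longrightarrow> g t < R \<Longrightarrow> g' t \<le> - k * g t"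
  shows "g T < R" "g T \<le> exp (- k * T) * g 0"
proof -
  have sub: "(g has_derivative (*) (g' t)) (at t within {0..u})" if "0 \<le> t" "t \<le> u" "u \<le> T" for t u
    unfolding has_field_derivative_def[symmetric]
    using that by (intro has_field_derivative_subset[OF deriv]) auto
  have cont: "continuous_on {0..T} g"
    using deriv by (intro DERIV_continuous_on)
  have below: "g t < R" if t: "t \<in> {0..T}" for t
  proof (rule ccontr)
    assume "\<not> g t < R"
    define A where "A = {0..T} \<inter> g -` {R..}"
    have "closed A" unfolding A_def using cont by (intro continuous_closed_preimage) auto
    then have "compact A" unfolding A_def by (simp add: compact_Int_closed compact_eq_bounded_closed bounded_subset[of "{0..T}"])
    moreover have "t \<in> A" using t \<open>\<not> g t < R\<close> by (simp add: A_def)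
    ultimately obtain u where u: "u \<in> A" "\<And>v. v \<in> A \<Longrightarrow> u \<le> v"
      using compact_attains_inf[of A] by blast
    have u0: "0 < u" "u \<le> T" "g u \<ge> R" using u(1) g0 by (auto simp: A_def less_le)
    obtain v where v: "v \<in> {0<..<u}" "g u - g 0 = g' v * (u - 0)"
      using mvt_simple[OF u0(1), of g "\<lambda>t. (*) (g' t)"] sub u0(2) by blast
    have "g v < R" using u(2)[of v] v(1) u0 by (force simp: A_def)
    then have "g' v \<le> - k * g v" using v(1) u0 by (intro decay) auto
    also have "\<dots> \<le> 0" using k nonneg[of v] by simp
    finally have "g' v * (u - 0) \<le> 0" using u0 by (simp add: mult_nonpos_nonneg)
    then show False using v u0 g0 by simp
  qed
  show "g T < R" using below T by simp
  show "g T \<le> exp (- k * T) * g 0"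
  proof (cases "T = 0")
    case False
    then have T0: "0 < T" using T by simp
    \<comment> \<open>Integrating factor: below the level, this product has nonpositive
      slope.\<close>
    have D: "((\<lambda>t. exp (k * t) * g t) has_derivative (*) (exp (k * t) * (k * g t + g' t))) (at t within {0..T})"
      if "0 \<le> t" "t \<le> T" for t
      using deriv[of t] that unfolding has_field_derivative_def[symmetric]
      by (auto intro!: derivative_eq_intros simp: algebra_simps)
    obtain v where v: "v \<in> {0<..<T}"
      "exp (k * T) * g T - exp (k * 0) * g 0 = (exp (k * v) * (k * g v + g' v)) * (T - 0)"
      using mvt_simple[OF T0, of "\<lambda>t. exp (k * t) * g t" "\<lambda>t. (*) (exp (k * t) * (k * g t + g' t))"] D by blast
    have "k * g v + g' v \<le> 0" using decay[of v] below[of v] v(1) by auto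
    then have "exp (k * v) * (k * g v + g' v) * (T - 0) \<le> 0"
      using T by (intro mult_nonpos_nonneg mult_nonneg_nonpos) auto
    then have "exp (k * T) * g T \<le> g 0" using v(2) by simp
    then show ?thesis by (simp add: exp_minus field_simps)
  qed simp
qed

theorem contraction_converges_const_metric:
  fixes f :: "real^'k \<Rightarrow> real \<Rightarrow> real^'k" and X :: "real^'k^'k"
  assumes X: "transpose X = X" "\<And>x. x \<noteq> 0 \<Longrightarrow> x \<bullet> (X *v x) > 0" and \<eta>: "\<eta> > 0"
    and diff: "\<And>x t. x \<in> D \<Longrightarrow> t \<ge> 0 \<Longrightarrow> (\<lambda>x. f x t) differentiable (at x)"
    and decay: "\<And>x t h. x \<in> D \<Longrightarrow> t \<ge> 0 \<Longrightarrow>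
      h \<bullet> (X *v (jacobian (\<lambda>x. f x t) (at x) *v h)) \<le> - \<eta> * (norm h)\<^sup>2"
    and xd: "trajectory_on {0..} f xd"
  shows "contraction_converges f D xd"
proof -
  obtain a where a: "a > 0" "\<And>z. a * (norm z)\<^sup>2 \<le> z \<bullet> (X *v z)"
    using quadratic_form_lower_bound[OF bilinear_inner_mv X(2)] by blast
  obtain b where b: "b > 0" "\<And>z. \<bar>z \<bullet> (X *v z)\<bar> \<le> b * (norm z)\<^sup>2"
    using quadratic_form_upper_bound[OF bilinear_inner_mv[of X]] by blast
  have b': "z \<bullet> (X *v z) \<le> b * (norm z)\<^sup>2" for z using b(2)[of z] by simp
  have X0: "0 \<le> z \<bullet> (X *v z)" for z using X(2)[of z] by (cases "z = 0") auto
  \<comment> \<open>Converts decay measured by the Euclidean norm into decay measured by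
    \<open>X\<close>. The constant \<open>sqrt (b / a)\<close> later converts back.\<close>
  define l where "l = \<eta> / b"
  have l: "l > 0" using \<eta> b by (simp add: l_def)
  have le: "- \<eta> * (norm z)\<^sup>2 \<le> - l * (z \<bullet> (X *v z))" for z
    using mult_left_mono[OF b'[of z], of l] l b(1) by (simp add: l_def)
  have tr: "transpose (X - mat r) = X - mat r" "transpose (mat r - X) = mat r - X" for r
    using X(1) by (auto simp: transpose_def vec_eq_iff mat_def)
  have metric: "contraction_metric f D (\<lambda>x t. X) l"
    unfolding contraction_metric_def
  proof (intro conjI l exI ballI allI impI)
    show "0 < a" "0 < b" by fact+
    show "possemidef (X - mat a)" "possemidef (mat b - X)"
      using a(2) b' by (simp_all add: possemidef_def tr matrix_vector_mult_diff_rdistrib mat_mv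
          inner_diff_right flip: power2_norm_eq_inner)
    show "C1_deriv_on (UNIV \<times> {0..}) (\<lambda>(x, t). X) (\<lambda>_. 0)"
      by (auto simp: C1_deriv_on_def split_def zero_blinfun.rep_eq)
    fix x t assume xt: "x \<in> D" "0 \<le> (t::real)"
    show "(\<lambda>x. f x t) differentiable at x" using diff xt .
    define F where "F = jacobian (\<lambda>x. f x t) (at x)"
    have TF: "z \<bullet> ((transpose F ** X) *v z) = z \<bullet> (X *v (F *v z))" for z
    proof -
      have "z \<bullet> ((transpose F ** X) *v z) = (F *v z) \<bullet> (X *v z)"
        using dot_lmul_matrix[of z "transpose F" "X *v z"] by (simp flip: matrix_vector_mul_assoc)
      also have "\<dots> = z \<bullet> (X *v (F *v z))" using inner_mv_symmetric[OF X(1)] .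
      finally show ?thesis .
    qed
    have "possemidef (- ((2 * l) *\<^sub>R X) - (transpose F ** X + X ** F))"
      unfolding possemidef_def
    proof (intro conjI allI)
      have "transpose (transpose F ** X) = X ** F" "transpose (X ** F) = transpose F ** X"
        by (simp_all add: matrix_transpose_mul X(1))
      moreover have "transpose (- ((2 * l) *\<^sub>R X) - (A + B)) = - ((2 * l) *\<^sub>R transpose X) - (transpose A + transpose B)"
        for A B :: "real^'k^'k" by (simp add: transpose_def vec_eq_iff)
      ultimately show "transpose (- ((2 * l) *\<^sub>R X) - (transpose F ** X + X ** F))
          = - ((2 * l) *\<^sub>R X) - (transpose F ** X + X ** F)"
        by (simp add: X(1) add.commute)
      fix z
      have "z \<bullet> ((- ((2 * l) *\<^sub>R X) - (transpose F ** X + X ** F)) *v z)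
          = - 2 * l * (z \<bullet> (X *v z)) - 2 * (z \<bullet> (X *v (F *v z)))"
        using TF[of z] by (simp add: matrix_vector_mult_diff_rdistrib matrix_vector_mult_add_rdistrib uminus_mv
            scaleR_mv inner_simps flip: matrix_vector_mul_assoc)
      also have "\<dots> \<ge> 0" using decay[OF xt, of z] le[of z] by (simp add: F_def)
      finally show "0 \<le> z \<bullet> ((- ((2 * l) *\<^sub>R X) - (transpose F ** X + X ** F)) *v z)" .
    qed
    then show "let F = jacobian (\<lambda>x. f x t) (at x) in possemidef (- ((2 * l) *\<^sub>R X)
        - (transpose F ** X + X ** F + blinfun_apply 0 (f x t, 1)))"
      by (simp add: F_def Let_def)
  qed
  have ball: "y \<in> riem_ball (\<lambda>x t. X) t x r \<longleftrightarrow> (y - x) \<bullet> (X *v (y - x)) < r\<^sup>2" if "r > 0" for t x y r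
  proof -
    have "sqrt q < r \<longleftrightarrow> q < r\<^sup>2" for q
      using that real_sqrt_less_iff[of q "r\<^sup>2"] by simp
    then show ?thesis by (simp add: riem_ball_def riem_dist_const[OF X])
  qed
  \<comment> \<open>The infinitesimal estimate, integrated along the segment, becomes a one-sided
    Lipschitz bound centered at \<open>x\<close>.\<close>
  have incr: "(y - x) \<bullet> (X *v (f y t - f x t)) \<le> - \<eta> * (norm (y - x))\<^sup>2"
    if r: "r > 0" and t: "t \<ge> 0" and sub: "riem_ball (\<lambda>x t. X) t x r \<subseteq> D"
      and y: "(y - x) \<bullet> (X *v (y - x)) < r\<^sup>2" for r t x y
  proof -
    define e where "e = y - x"
    have inD: "x + s *\<^sub>R e \<in> D" if "s \<in> {0..1}" for s
    proof -
      have "(s *\<^sub>R e) \<bullet> (X *v (s *\<^sub>R e)) = s\<^sup>2 * (e \<bullet> (X *v e))"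
        by (simp add: matrix_vector_mult_scaleR power2_eq_square)
      also have "\<dots> \<le> 1 * (e \<bullet> (X *v e))" using that X0[of e] by (intro mult_right_mono) (auto simp: power_le_one)
      also have "\<dots> < r\<^sup>2" using y by (simp add: e_def)
      finally show ?thesis using sub ball[OF r, of "x + s *\<^sub>R e" t x] by auto
    qed
    have blin: "bounded_linear (\<lambda>v. e \<bullet> (X *v v))"
      using bilinear_inner_mv[of X] by (auto simp: bilinear_def linear_conv_bounded_linear)
    define J where "J s = jacobian (\<lambda>x. f x t) (at (x + s *\<^sub>R e))" for s
    have "((\<lambda>s. e \<bullet> (X *v f (x + s *\<^sub>R e) t)) has_derivative (\<lambda>h. e \<bullet> (X *v (J s *v (h *\<^sub>R e))))) (at s within {0..1})"
      if s: "s \<in> {0..1}" for s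
    proof -
      have "((\<lambda>s. x + s *\<^sub>R e) has_derivative (\<lambda>h. h *\<^sub>R e)) (at s within {0..1})"
        by (auto intro!: derivative_eq_intros)
      moreover have "((\<lambda>x. f x t) has_derivative (\<lambda>h. J s *v h)) (at (x + s *\<^sub>R e))"
        using diff[OF inD[OF s] t] by (simp add: J_def jacobian_works)
      ultimately have "((\<lambda>s. f (x + s *\<^sub>R e) t) has_derivative (\<lambda>h. J s *v (h *\<^sub>R e))) (at s within {0..1})"
        by (rule has_derivative_compose)
      then show ?thesis by (rule bounded_linear.has_derivative[OF blin])
    qed
    then obtain s where s: "s \<in> {0<..<1}"
      "e \<bullet> (X *v f (x + 1 *\<^sub>R e) t) - e \<bullet> (X *v f (x + 0 *\<^sub>R e) t) = e \<bullet> (X *v (J s *v ((1 - 0) *\<^sub>R e)))"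
      using mvt_simple[of 0 1 "\<lambda>s. e \<bullet> (X *v f (x + s *\<^sub>R e) t)" "\<lambda>s h. e \<bullet> (X *v (J s *v (h *\<^sub>R e)))"]
      by auto
    have "e \<bullet> (X *v (f y t - f x t)) = e \<bullet> (X *v (J s *v e))"
      using s(2) by (simp add: e_def matrix_vector_mult_diff_distrib inner_diff_right)
    also have "\<dots> \<le> - \<eta> * (norm e)\<^sup>2" unfolding J_def using s(1) by (intro decay inD t) auto
    finally show ?thesis by (simp add: e_def)
  qed
  have bb: "bounded_bilinear (\<lambda>x y. x \<bullet> (X *v y))"
    using bilinear_inner_mv[of X] by (simp add: bilinear_conv_bounded_bilinear)
  have main: "x t \<in> riem_ball (\<lambda>x t. X) t (xd t) r \<and>
      norm (x t - xd t) \<le> sqrt (b / a) * exp (- l * t) * norm (x 0 - xd 0)"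
    if r: "r > 0" and sub: "\<And>t. t \<ge> 0 \<Longrightarrow> riem_ball (\<lambda>x t. X) t (xd t) r \<subseteq> D"
      and I: "is_interval I" "0 \<in> I" "I \<subseteq> {0..}" and x: "trajectory_on I f x"
      and x0: "x 0 \<in> riem_ball (\<lambda>x t. X) 0 (xd 0) r" and t: "t \<in> I" for r I x t
  proof -
    have t0: "0 \<le> t" using I t by auto
    \<comment> \<open>Only the past of a fixed time is used, so nothing is needed about the
      existence of the trajectory beyond \<open>t\<close>.\<close>
    have sI: "{0..t} \<subseteq> I" using I t by (auto intro: mem_is_interval_1_I[of I 0 t])
    define e where "e s = x s - xd s" for s
    define e' where "e' s = f (x s) s - f (xd s) s" for s
    define g where "g s = e s \<bullet> (X *v e s)" for s
    have de: "(e has_vector_derivative e' s) (at s within {0..t})" if s: "s \<in> {0..t}" for s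
    proof -
      have sI': "s \<in> I" using s sI by blast
      have "(x has_vector_derivative f (x s) s) (at s within I)"
        using x sI' unfolding trajectory_on_def by blast
      then have 1: "(x has_vector_derivative f (x s) s) (at s within {0..t})"
        by (rule has_vector_derivative_within_subset) (rule sI)
      have "(xd has_vector_derivative f (xd s) s) (at s within {0..})"
        using xd s unfolding trajectory_on_def by simp
      then have 2: "(xd has_vector_derivative f (xd s) s) (at s within {0..t})"
        by (rule has_vector_derivative_within_subset) auto
      show ?thesis unfolding e_def[abs_def] e'_def by (rule has_vector_derivative_diff[OF 1 2])
    qed
    have dg: "(g has_real_derivative 2 * (e s \<bullet> (X *v e' s))) (at s within {0..t})" if s: "s \<in> {0..t}" for s
    proof -
      have "(g has_vector_derivative (e s \<bullet> (X *v e' s) + e' s \<bullet> (X *v e s))) (at s within {0..t})"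
        unfolding g_def using bounded_bilinear.has_vector_derivative[OF bb de[OF s] de[OF s]] .
      then show ?thesis
        using inner_mv_symmetric[OF X(1), of "e' s" "e s"] by (simp add: has_real_derivative_iff_has_vector_derivative)
    qed
    have dec: "2 * (e s \<bullet> (X *v e' s)) \<le> - (2 * l) * g s" if s: "s \<in> {0..t}" and gs: "g s < r\<^sup>2" for s
    proof -
      have "e s \<bullet> (X *v e' s) \<le> - \<eta> * (norm (e s))\<^sup>2"
        unfolding e_def e'_def using s gs by (intro incr[OF r _ sub]) (auto simp: g_def e_def)
      also have "\<dots> \<le> - l * g s" unfolding g_def by (rule le)
      finally show ?thesis by simp
    qed
    have g0: "g 0 < r\<^sup>2" using x0 ball[OF r] by (simp add: g_def e_def)
    have gnn: "0 \<le> g s" for s by (simp add: g_def X0)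
    have l2: "0 \<le> 2 * l" using l by simp
    note D = decay_while_below[OF t0 g0 gnn l2 dg dec]
    have "a * (norm (e t))\<^sup>2 \<le> g t" unfolding g_def by (rule a)
    also have "\<dots> \<le> exp (- (2 * l) * t) * g 0" by (rule D(2))
    also have "\<dots> \<le> exp (- (2 * l) * t) * (b * (norm (e 0))\<^sup>2)"
      unfolding g_def by (intro mult_left_mono b') auto
    finally have "(norm (e t))\<^sup>2 \<le> (b / a) * (exp (- l * t))\<^sup>2 * (norm (e 0))\<^sup>2"
      using a(1) by (simp add: field_simps flip: exp_double)
    also have "\<dots> = (sqrt (b / a) * exp (- l * t) * norm (e 0))\<^sup>2"
      using a(1) b(1) by (simp add: power_mult_distrib)
    finally have "norm (e t) \<le> sqrt (b / a) * exp (- l * t) * norm (e 0)"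
      using a(1) b(1) by (intro power2_le_imp_le[of "norm (e t)"]) auto
    then show ?thesis using D(1) ball[OF r] by (simp add: g_def e_def)
  qed
  show ?thesis
    unfolding contraction_converges_def
  proof (rule exI[of _ "\<lambda>x t. X"], rule exI[of _ l], rule exI[of _ "sqrt (b / a)"], rule exI[of _ l],
      intro conjI metric l allI impI ballI)
    show "sqrt (b / a) > 0" using a b by simp
  qed (use main in \<open>blast+\<close>)
qed

section \<open>The closed loop as a gradient system\<close>

lemma bounded_linear_vfst: "bounded_linear (vfst :: real^('m::finite + 'n::finite) \<Rightarrow> real^'m)"
  and bounded_linear_vsnd: "bounded_linear (vsnd :: real^('m + 'n) \<Rightarrow> real^'n)"
  and bounded_linear_vjoin_left: "bounded_linear (\<lambda>x. vjoin x 0 :: real^('m + 'n))"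
  and bounded_linear_vjoin_right: "bounded_linear (\<lambda>x. vjoin 0 x :: real^('m + 'n))"
  unfolding linear_conv_bounded_linear[symmetric]
  by (auto intro!: linearI simp: vfst_def vsnd_def vjoin_def vec_eq_iff split: sum.split)

lemma has_derivative_vfst: "(f has_derivative f') F \<Longrightarrow> ((\<lambda>x. vfst (f x)) has_derivative (\<lambda>h. vfst (f' h))) F"
  for f :: "_ \<Rightarrow> real^('m::finite + 'n::finite)"
  by (rule bounded_linear.has_derivative[OF bounded_linear_vfst])

lemma has_derivative_vsnd: "(f has_derivative f') F \<Longrightarrow> ((\<lambda>x. vsnd (f x)) has_derivative (\<lambda>h. vsnd (f' h))) F"
  for f :: "_ \<Rightarrow> real^('m::finite + 'n::finite)"
  by (rule bounded_linear.has_derivative[OF bounded_linear_vsnd])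

lemma has_derivative_mv: "(f has_derivative f') F \<Longrightarrow> ((\<lambda>x. A *v f x) has_derivative (\<lambda>h. A *v f' h)) F"
  for A :: "real^'n^'m"
  by (rule bounded_linear.has_derivative[OF matrix_vector_mul_bounded_linear])

lemma has_derivative_vjoin:
  fixes f :: "_ \<Rightarrow> real^'m" and g :: "_ \<Rightarrow> real^'n"
  assumes "(f has_derivative f') F" "(g has_derivative g') F"
  shows "((\<lambda>x. vjoin (f x) (g x)) has_derivative (\<lambda>h. vjoin (f' h) (g' h))) F"
  using has_derivative_add[OF bounded_linear.has_derivative[OF bounded_linear_vjoin_left assms(1)]
      bounded_linear.has_derivative[OF bounded_linear_vjoin_right assms(2)]]
  by (simp add: vjoin_add)

lemma grad_eqI:
  assumes "(f has_derivative (\<lambda>h. g \<bullet> h)) (at x)"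
  shows "grad f x = g"
  by (simp add: grad_def vec_eq_iff inner_axis flip: frechet_derivative_at[OF assms])

lemma has_derivative_grad:
  assumes "f differentiable (at x)"
  shows "(f has_derivative (\<lambda>h. grad f x \<bullet> h)) (at x)"
proof -
  define f' where "f' = frechet_derivative f (at x)"
  have f': "(f has_derivative f') (at x)" unfolding f'_def using assms by (simp add: frechet_derivative_works)
  interpret linear f' using f' has_derivative_linear by blast
  have "f' h = grad f x \<bullet> h" for h
  proof -
    have "f' h = f' (\<Sum>i\<in>UNIV. h $ i *\<^sub>R axis i 1)"
      using basis_expansion[of h] by (simp add: scalar_mult_eq_scaleR)
    also have "\<dots> = grad f x \<bullet> h"
      by (simp add: sum scale grad_def inner_vec_def mult.commute flip: f'_def)
    finally show ?thesis .
  qed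
  then have "f' = (\<lambda>h. grad f x \<bullet> h)" by blast
  then show ?thesis using f' by simp
qed

lemma has_derivative_quadratic:
  fixes A :: "real^'n^'n"
  assumes A: "transpose A = A" and f: "(f has_derivative f') (at x)"
  shows "((\<lambda>x. 1/2 * (f x \<bullet> (A *v f x))) has_derivative (\<lambda>h. (A *v f x) \<bullet> f' h)) (at x)"
proof -
  have "((\<lambda>x. f x \<bullet> (A *v f x)) has_derivative (\<lambda>h. f x \<bullet> (A *v f' h) + f' h \<bullet> (A *v f x))) (at x)"
    by (intro has_derivative_inner f has_derivative_mv)
  then have "((\<lambda>x. 1/2 * (f x \<bullet> (A *v f x))) has_derivative
      (\<lambda>h. 1/2 * (f x \<bullet> (A *v f' h) + f' h \<bullet> (A *v f x)))) (at x)"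
    by (rule has_derivative_mult_right)
  moreover have "1/2 * (f x \<bullet> (A *v f' h) + f' h \<bullet> (A *v f x)) = (A *v f x) \<bullet> f' h" for h
    using inner_mv_symmetric[OF A, of "f x" "f' h"] by (simp add: inner_commute)
  ultimately show ?thesis by simp
qed

lemma posdef_invertible:
  fixes M :: "real^'n^'n"
  assumes "posdef M"
  shows "invertible M"
proof -
  have "x = 0" if "M *v x = 0" for x
    using assms that unfolding posdef_def by (metis inner_zero_right less_irrefl)
  then show ?thesis
    using matrix_left_invertible_ker[of M] by (simp add: invertible_left_inverse)
qed

lemma matrix_inv_inverse:
  fixes A :: "real^'n^'n"
  assumes "invertible A"
  shows "A ** matrix_inv A = mat 1" "matrix_inv A ** A = mat 1"
  using someI_ex[OF assms[unfolded invertible_def]] by (simp_all add: matrix_inv_def)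

lemma posdef_matrix_inv_symmetric:
  assumes "posdef (M :: real^'n^'n)"
  shows "transpose (matrix_inv M) = matrix_inv M"
proof -
  note inv = matrix_inv_inverse[OF posdef_invertible[OF assms]]
  have "transpose M = M" using assms by (simp add: posdef_def)
  then have "transpose (matrix_inv M) ** M = mat 1"
    using inv(1) matrix_transpose_mul[of M "matrix_inv M"] by (simp add: transpose_mat)
  then have "transpose (matrix_inv M) ** (M ** matrix_inv M) = matrix_inv M"
    by (simp add: matrix_mul_assoc)
  then show ?thesis using inv(1) by simp
qed

lemma posdef_diff_mat:
  fixes A :: "real^'n^'n"
  shows "posdef (A - mat a) \<Longrightarrow> a * (norm z)\<^sup>2 \<le> z \<bullet> (A *v z)" (is "_ \<Longrightarrow> ?lower")
    and "posdef (mat a - A) \<Longrightarrow> z \<bullet> (A *v z) \<le> a * (norm z)\<^sup>2"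
    and "posdef (A - mat a) \<Longrightarrow> transpose A = A"
proof -
  have nonneg: "0 \<le> z \<bullet> (B *v z)" if "posdef B" for B :: "real^'n^'n"
    using that by (cases "z = 0") (auto simp: posdef_def less_imp_le)
  show "posdef (A - mat a) \<Longrightarrow> ?lower" "posdef (mat a - A) \<Longrightarrow> z \<bullet> (A *v z) \<le> a * (norm z)\<^sup>2"
    using nonneg[of "A - mat a"] nonneg[of "mat a - A"]
    by (simp_all add: matrix_vector_mult_diff_rdistrib mat_mv inner_diff_right power2_norm_eq_inner)
  show "transpose A = A" if "posdef (A - mat a)"
  proof -
    have "transpose (A - mat a) = transpose A - mat a"
      by (auto simp: transpose_def mat_def vec_eq_iff)
    then show ?thesis using that by (simp add: posdef_def)
  qed
qed

text \<open>Dimension count: the rows span an \<open>n - m\<close> dimensional subspace of the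
  orthogonal complement of the range, hence all of it, and the double complement of the range is the
  range. For \<open>m = n\<close> there are no rows and the range is the whole space.\<close>

lemma left_annihilator_range:
  fixes g :: "real^'m^'n"
  assumes le: "CARD('m) \<le> CARD('n)" and g: "rank g = CARD('m)" and W: "left_annihilator W g"
    and v: "\<And>i. i < CARD('n) - CARD('m) \<Longrightarrow> W i \<bullet> v = 0"
  shows "v \<in> range ((*v) g)"
proof -
  define A where "A = range ((*v) g)"
  define K where "K = span (W ` {..<CARD('n) - CARD('m)})"
  have subA: "subspace A" unfolding A_def by (intro linear_subspace_image) auto
  have dimA: "dim A = CARD('m)" using g by (simp add: A_def rank_dim_range)
  have perp: "{y. \<forall>x\<in>A. orthogonal x y} = A\<^sup>\<bottom>"
    by (auto simp: orthogonal_comp_def orthogonal_commute)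
  have "dim (A\<^sup>\<bottom>) + dim A = CARD('n)"
    using dim_subspace_orthogonal_to_vectors[OF subA subspace_UNIV] by (simp add: perp)
  then have dimP: "dim (A\<^sup>\<bottom>) = CARD('n) - CARD('m)" using dimA by simp
  have "W i \<in> A\<^sup>\<bottom>" if "i < CARD('n) - CARD('m)" for i
  proof -
    have "W i \<bullet> (g *v x) = 0" for x
      using W that dot_lmul_matrix[of "W i" g x] by (simp add: left_annihilator_def)
    then show ?thesis by (auto simp: A_def orthogonal_comp_def orthogonal_def inner_commute)
  qed
  then have "K \<subseteq> A\<^sup>\<bottom>"
    unfolding K_def by (intro span_minimal subspace_orthogonal_comp) auto
  moreover have "dim K = CARD('n) - CARD('m)"
    using W by (simp add: K_def left_annihilator_def dim_eq_card_independent card_image)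
  ultimately have "K = A\<^sup>\<bottom>"
    using dimP by (intro subspace_dim_equal) (auto simp: K_def subspace_orthogonal_comp)
  moreover have "orthogonal v k" if "k \<in> K" for k
    using that unfolding K_def
  proof (rule orthogonal_to_span)
    fix y assume "y \<in> W ` {..<CARD('n) - CARD('m)}"
    then show "orthogonal v y" using v by (auto simp: orthogonal_def inner_commute[of v])
  qed
  ultimately have "\<forall>k\<in>A\<^sup>\<bottom>. orthogonal k v" by (simp add: orthogonal_commute)
  then have "v \<in> A\<^sup>\<bottom>\<^sup>\<bottom>" unfolding orthogonal_comp_def[of "A\<^sup>\<bottom>"] by blast
  then show ?thesis unfolding orthogonal_comp_self[OF subA] by (simp add: A_def)
qed

text \<open>Full column rank makes \<open>left_pinv g\<close> a left inverse of \<open>g\<close>, so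
  their product in the other order fixes the range of \<open>g\<close>. Thus the controller realizes
  exactly every force in the range of \<open>G\<close>.\<close>

lemma left_pinv_range:
  fixes g :: "real^'m^'n"
  assumes g: "rank g = CARD('m)" and v: "v \<in> range ((*v) g)"
  shows "g *v (left_pinv g *v v) = v"
proof -
  have inj: "inj ((*v) g)" using g by (simp add: full_rank_injective)
  have "x = 0" if "(transpose g ** g) *v x = 0" for x
  proof -
    have "(g *v x) \<bullet> (g *v x) = x \<bullet> ((transpose g ** g) *v x)"
      using dot_lmul_matrix[of x "transpose g" "g *v x"] by (simp flip: matrix_vector_mul_assoc)
    then have "g *v x = g *v 0" using that by simp
    then show ?thesis using injD[OF inj] by blast
  qed
  then have "invertible (transpose g ** g)"
    using matrix_left_invertible_ker[of "transpose g ** g"] by (simp add: invertible_left_inverse)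
  then have "left_pinv g ** g = mat 1"
    using matrix_inv_inverse(2)[of "transpose g ** g"] by (simp add: left_pinv_def matrix_mul_assoc)
  moreover obtain x where "v = g *v x" using v by blast
  ultimately show ?thesis by (simp add: matrix_vector_mul_assoc)
qed

lemma P_mat_mv: "P_mat J S1 S2 Fe *v vjoin a (vjoin b c)
    = vjoin (J *v b) (vjoin (S1 *v c - transpose J *v a) (S2 *v a + Fe *v c))"
  by (simp add: P_mat_def block_vjoin hcat_vjoin vcat_mult vjoin_add uminus_mv)

context
  fixes Md :: "real^'n^'n" and Me :: "real^'m^'m" and Vd :: "real^'n \<Rightarrow> real^'m \<Rightarrow> real \<Rightarrow> real" and t :: real
  assumes Md: "posdef Md" and Me: "posdef Me"
    and Vd: "\<And>z. (\<lambda>z. Vd (vfst z) (vsnd z) t) differentiable (at z)"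
      "\<And>z. grad (\<lambda>z. Vd (vfst z) (vsnd z) t) differentiable (at z)"
begin

abbreviation (input) "Wd \<equiv> (\<lambda>z. Vd (vfst z) (vsnd z) t)"

text \<open>The controller uses partial gradients while smoothness is assumed jointly; the chain
  rule along the two coordinate embeddings identifies them with the blocks of the joint
  gradient.\<close>

lemma grad_Vd_parts:
  "grad_q_Vd Vd q qe t = vfst (grad Wd (vjoin q qe))"
  "grad_qe_Vd Vd q qe t = vsnd (grad Wd (vjoin q qe))"
proof -
  note W = has_derivative_grad[OF Vd(1), of "vjoin q qe"]
  have "((\<lambda>x. Vd x qe t) has_derivative (\<lambda>h. grad Wd (vjoin q qe) \<bullet> vjoin h 0)) (at q)"
    using has_derivative_compose[OF has_derivative_vjoin[OF has_derivative_ident has_derivative_const], OF W] by simp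
  then show "grad_q_Vd Vd q qe t = vfst (grad Wd (vjoin q qe))"
    unfolding grad_q_Vd_def using inner_vjoin[of "vfst (grad Wd (vjoin q qe))" "vsnd (grad Wd (vjoin q qe))"]
    by (intro grad_eqI) simp
  have "((\<lambda>x. Vd q x t) has_derivative (\<lambda>h. grad Wd (vjoin q qe) \<bullet> vjoin 0 h)) (at qe)"
    using has_derivative_compose[OF has_derivative_vjoin[OF has_derivative_const has_derivative_ident], OF W] by simp
  then show "grad_qe_Vd Vd q qe t = vsnd (grad Wd (vjoin q qe))"
    unfolding grad_qe_Vd_def using inner_vjoin[of "vfst (grad Wd (vjoin q qe))" "vsnd (grad Wd (vjoin q qe))"]
    by (intro grad_eqI) simp
qed

lemma has_derivative_Hd:
  "((\<lambda>\<xi>. Hd Md Me Vd \<xi> t) has_derivative (\<lambda>h. vjoin (grad_q_Vd Vd (q_of \<xi>) (vfst (xe_of \<xi>)) t)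
     (vjoin (matrix_inv Md *v p_of \<xi>)
       (vjoin (grad_qe_Vd Vd (q_of \<xi>) (vfst (xe_of \<xi>)) t) (matrix_inv Me *v vsnd (xe_of \<xi>)))) \<bullet> h)) (at \<xi>)"
proof -
  let ?z = "\<lambda>\<xi>. vjoin (vfst \<xi>) (vfst (vsnd (vsnd \<xi>)))"
  have "((\<lambda>\<xi>. 1/2 * (vfst (vsnd \<xi>) \<bullet> (matrix_inv Md *v vfst (vsnd \<xi>)))
      + 1/2 * (vsnd (vsnd (vsnd \<xi>)) \<bullet> (matrix_inv Me *v vsnd (vsnd (vsnd \<xi>)))) + Wd (?z \<xi>)) has_derivative
    (\<lambda>h. (matrix_inv Md *v vfst (vsnd \<xi>)) \<bullet> vfst (vsnd h)
      + (matrix_inv Me *v vsnd (vsnd (vsnd \<xi>))) \<bullet> vsnd (vsnd (vsnd h)) + grad Wd (?z \<xi>) \<bullet> ?z h)) (at \<xi>)"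
    by (intro has_derivative_add has_derivative_quadratic posdef_matrix_inv_symmetric Md Me
        has_derivative_vfst has_derivative_vsnd has_derivative_ident
        has_derivative_compose[OF _ has_derivative_grad[OF Vd(1)], of ?z] has_derivative_vjoin)
  moreover have "(matrix_inv Md *v vfst (vsnd \<xi>)) \<bullet> vfst (vsnd h)
      + (matrix_inv Me *v vsnd (vsnd (vsnd \<xi>))) \<bullet> vsnd (vsnd (vsnd h)) + grad Wd (?z \<xi>) \<bullet> ?z h
    = vjoin (grad_q_Vd Vd (q_of \<xi>) (vfst (xe_of \<xi>)) t)
     (vjoin (matrix_inv Md *v p_of \<xi>)
       (vjoin (grad_qe_Vd Vd (q_of \<xi>) (vfst (xe_of \<xi>)) t) (matrix_inv Me *v vsnd (xe_of \<xi>)))) \<bullet> h" for h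
    using inner_vjoin[of "vfst (grad Wd (?z \<xi>))" "vsnd (grad Wd (?z \<xi>))" "vfst h" "vfst (vsnd (vsnd h))"]
      inner_vjoin[of _ _ "vfst h" "vsnd h"] inner_vjoin[of _ _ "vfst (vsnd h)" "vsnd (vsnd h)"]
      inner_vjoin[of _ _ "vfst (vsnd (vsnd h))" "vsnd (vsnd (vsnd h))"]
    by (simp add: grad_Vd_parts q_of_def p_of_def xe_of_def)
  ultimately show ?thesis
    by (simp add: Hd_def Let_def q_of_def p_of_def xe_of_def)
qed

lemma grad_Hd:
  "grad (\<lambda>\<xi>. Hd Md Me Vd \<xi> t) \<xi> = vjoin (grad_q_Vd Vd (q_of \<xi>) (vfst (xe_of \<xi>)) t)
     (vjoin (matrix_inv Md *v p_of \<xi>)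
       (vjoin (grad_qe_Vd Vd (q_of \<xi>) (vfst (xe_of \<xi>)) t) (matrix_inv Me *v vsnd (xe_of \<xi>))))"
  by (rule grad_eqI[OF has_derivative_Hd])

lemma grad_xe_Hd:
  "grad_xe_Hd Md Me Vd \<xi> t = vjoin (grad_qe_Vd Vd (q_of \<xi>) (vfst (xe_of \<xi>)) t) (matrix_inv Me *v vsnd (xe_of \<xi>))"
proof -
  have eq: "vjoin (q_of \<xi>) (vjoin (p_of \<xi>) (xe_of \<xi>)) = \<xi>" by (simp add: q_of_def p_of_def xe_of_def)
  have "((\<lambda>xe. Hd Md Me Vd (vjoin (q_of \<xi>) (vjoin (p_of \<xi>) xe)) t) has_derivative
    (\<lambda>h. grad (\<lambda>\<xi>. Hd Md Me Vd \<xi> t) \<xi> \<bullet> vjoin 0 (vjoin 0 h))) (at (xe_of \<xi>))"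
  proof (rule has_derivative_compose[of "\<lambda>xe. vjoin (q_of \<xi>) (vjoin (p_of \<xi>) xe)"])
    show "((\<lambda>\<xi>. Hd Md Me Vd \<xi> t) has_derivative (\<bullet>) (grad (\<lambda>\<xi>. Hd Md Me Vd \<xi> t) \<xi>))
        (at (vjoin (q_of \<xi>) (vjoin (p_of \<xi>) (xe_of \<xi>))))"
      unfolding eq grad_Hd by (rule has_derivative_Hd)
  qed (intro has_derivative_vjoin has_derivative_const has_derivative_ident)
  then show ?thesis
    unfolding grad_xe_Hd_def by (intro grad_eqI) (simp add: grad_Hd inner_vjoin)
qed

lemma differentiable_grad_Hd: "grad (\<lambda>\<xi>. Hd Md Me Vd \<xi> t) differentiable (at \<xi>)"
proof -
  let ?z = "\<lambda>\<xi> :: real^('n + 'n + 'm + 'm). vjoin (vfst \<xi>) (vfst (vsnd (vsnd \<xi>)))"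
  obtain W' where W': "(grad Wd has_derivative W') (at (?z \<xi>))" using Vd(2) by (auto simp: differentiable_def)
  have z: "(?z has_derivative ?z) (at \<xi>)"
    by (intro has_derivative_vjoin has_derivative_vfst has_derivative_vsnd has_derivative_ident)
  have "((\<lambda>\<xi>. vjoin (vfst (grad Wd (?z \<xi>))) (vjoin (matrix_inv Md *v vfst (vsnd \<xi>))
      (vjoin (vsnd (grad Wd (?z \<xi>))) (matrix_inv Me *v vsnd (vsnd (vsnd \<xi>)))))) has_derivative
    (\<lambda>h. vjoin (vfst (W' (?z h))) (vjoin (matrix_inv Md *v vfst (vsnd h))
      (vjoin (vsnd (W' (?z h))) (matrix_inv Me *v vsnd (vsnd (vsnd h))))))) (at \<xi>)"
    by (intro has_derivative_vjoin has_derivative_vfst has_derivative_vsnd has_derivative_mv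
        has_derivative_ident has_derivative_compose[OF z W'])
  moreover have "grad (\<lambda>\<xi>. Hd Md Me Vd \<xi> t) = (\<lambda>\<xi>. vjoin (vfst (grad Wd (?z \<xi>))) (vjoin (matrix_inv Md *v vfst (vsnd \<xi>))
      (vjoin (vsnd (grad Wd (?z \<xi>))) (matrix_inv Me *v vsnd (vsnd (vsnd \<xi>))))))"
    by (rule ext) (simp add: grad_Hd grad_Vd_parts q_of_def p_of_def xe_of_def)
  ultimately show ?thesis by (auto simp: differentiable_def)
qed

text \<open>The \<open>q\<close> row is \<open>matching1\<close>, and the \<open>x_e\<close> row
  holds by the choice of the controller dynamics. In the \<open>p\<close> row,
  \<open>matching2\<close> says that the force \<open>v\<close> to be supplied by \<open>G u\<close>
  is orthogonal to the annihilator; so it lies in the range of \<open>G\<close>, the pseudoinverse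
  produces it exactly, and \<open>grad V\<close> cancels.\<close>

lemma closed_loop_eq_grad:
  fixes G :: "real^'n \<Rightarrow> real^'m^'n"
  assumes dims: "CARD('m) \<le> CARD('n)" and M: "posdef M"
    and V: "\<And>q. V differentiable (at q)"
    and G: "\<And>q. rank (G q) = CARD('m)" and Gperp: "\<And>q. left_annihilator (Gperp q) (G q)"
    and S1: "S1 = hcat s11 s12"
    and matching1: "\<And>p. matrix_inv M *v p = J *v (matrix_inv Md *v p)"
    and matching2: "\<And>q qe pe i. i < CARD('n) - CARD('m) \<Longrightarrow>
      Gperp q i \<bullet> (grad V q - transpose J *v grad_q_Vd Vd q qe t
        + s11 *v grad_qe_Vd Vd q qe t + s12 *v (matrix_inv Me *v pe)) = 0"
  shows "closed_loop M V G J Md Me Vd S1 S2 Fe \<xi> t = P_mat J S1 S2 Fe *v grad (\<lambda>\<xi>. Hd Md Me Vd \<xi> t) \<xi>"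
proof -
  define q p qe pe where "q = q_of \<xi>" "p = p_of \<xi>" "qe = vfst (xe_of \<xi>)" "pe = vsnd (xe_of \<xi>)"
  note defs = q_p_qe_pe_def
  define a b where "a = grad_q_Vd Vd q qe t" "b = grad_qe_Vd Vd q qe t"
  have qdot: "mech_qdot M V q p = J *v (matrix_inv Md *v p)"
  proof -
    have "((\<lambda>p. 1/2 * (p \<bullet> (matrix_inv M *v p)) + V q) has_derivative (\<lambda>h. (matrix_inv M *v p) \<bullet> h + 0)) (at p)"
      by (intro has_derivative_add has_derivative_quadratic posdef_matrix_inv_symmetric[OF M]
          has_derivative_ident has_derivative_const)
    then show ?thesis unfolding mech_qdot_def mech_H_def
      by (subst grad_eqI) (auto simp: matching1)
  qed
  have gV: "grad (\<lambda>q. mech_H M V q p) q = grad V q"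
  proof -
    have "((\<lambda>q. 1/2 * (p \<bullet> (matrix_inv M *v p)) + V q) has_derivative (\<lambda>h. 0 + grad V q \<bullet> h)) (at q)"
      by (intro has_derivative_add has_derivative_const has_derivative_grad V)
    then show ?thesis unfolding mech_H_def by (intro grad_eqI) simp
  qed
  have xe: "grad_xe_Hd Md Me Vd \<xi> t = vjoin b (matrix_inv Me *v pe)"
    by (simp add: grad_xe_Hd defs a_b_def)
  define v where "v = - (transpose J *v a) + S1 *v vjoin b (matrix_inv Me *v pe) + grad V q"
  have "v \<in> range ((*v) (G q))"
    using matching2[of _ q qe pe]
    by (intro left_annihilator_range[OF dims G Gperp])
      (simp add: v_def S1 hcat_vjoin a_b_def algebra_simps del: transpose_matrix_vector)
  then have Gv: "G q *v (left_pinv (G q) *v v) = v" by (rule left_pinv_range[OF G])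
  have "control V G J Md Me Vd S1 \<xi> t = left_pinv (G q) *v v"
    by (simp add: control_def xe v_def a_b_def flip: defs)
  then have "mech_pdot M V G q p (control V G J Md Me Vd S1 \<xi> t) = - grad V q + v"
    by (simp only: mech_pdot_def gV Gv)
  also have "\<dots> = S1 *v vjoin b (matrix_inv Me *v pe) - transpose J *v a" by (simp add: v_def)
  finally show ?thesis
    by (simp add: closed_loop_def grad_Hd P_mat_mv qdot xe a_b_def flip: defs)
qed

end

theorem theorem2:
  fixes M Md J :: "real^'n^'n"
    and V :: "real^'n \<Rightarrow> real"
    and G :: "real^'n \<Rightarrow> real^'m^'n"
    and Gperp :: "real^'n \<Rightarrow> nat \<Rightarrow> real^'n"
    and Me :: "real^'m^'m"
    and Vd :: "real^'n \<Rightarrow> real^'m \<Rightarrow> real \<Rightarrow> real"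
    and s11 s12 :: "real^'m^'n"
    and S1 :: "real^('m + 'm)^'n"
    and S2 :: "real^'n^('m + 'm)"
    and Fe J_e R_e :: "real^('m + 'm)^('m + 'm)"
    and P :: "real^('n + 'n + 'm + 'm)^('n + 'n + 'm + 'm)"
    and qd pd :: "real \<Rightarrow> real^'n"
    and xed :: "real \<Rightarrow> real^('m + 'm)"
    and \<xi>d :: "real \<Rightarrow> real^('n + 'n + 'm + 'm)"
    and \<alpha> \<beta> \<epsilon> :: real
    and D :: "(real^('n + 'n + 'm + 'm)) set"
  assumes dims: "CARD('m) \<le> CARD('n)"
    and M: "posdef M"
    and V: "\<forall>q. V q \<ge> 0" "C2_timed (\<lambda>q t. V q)"
    and G: "\<exists>G'. C1_deriv_on UNIV G G'" "\<forall>q. rank (G q) = CARD('m)"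
    and Gperp: "\<forall>q. left_annihilator (Gperp q) (G q)"
    and feasible: "feasible_traj M V G qd pd"
    and pd: "\<forall>t\<ge>0. pd t = M *v vector_derivative qd (at t within {0..})"
    and Md: "posdef Md" and Me: "posdef Me"
    and Vd: "\<forall>q qe. \<forall>t\<ge>0. Vd q qe t \<ge> 0" "C2_timed (\<lambda>z t. Vd (vfst z) (vsnd z) t)"
    and S1: "S1 = hcat s11 s12" "full_rank S1"
    and S2: "full_rank S2"
    and Fe: "Fe = J_e - R_e" "J_e = - transpose J_e" "posdef R_e"
    and P: "P = P_mat J S1 S2 Fe"
    and matching1: "\<forall>p. matrix_inv M *v p = J *v (matrix_inv Md *v p)"
    and matching2: "\<forall>q qe pe. \<forall>t\<ge>0. \<forall>i < CARD('n) - CARD('m).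
      Gperp q i \<bullet> (grad V q - transpose J *v grad_q_Vd Vd q qe t
        + s11 *v grad_qe_Vd Vd q qe t + s12 *v (matrix_inv Me *v pe)) = 0"
    and hurwitz: "hurwitz P"
    and bounds: "0 < \<alpha>" "\<alpha> < \<beta>" "open D"
      "\<forall>\<xi>\<in>D. \<forall>t\<ge>0. posdef (hess (\<lambda>\<xi>. Hd Md Me Vd \<xi> t) \<xi> - mat \<alpha>) \<and>
                       posdef (mat \<beta> - hess (\<lambda>\<xi>. Hd Md Me Vd \<xi> t) \<xi>)"
    and N: "\<epsilon> > 0" "\<forall>z. Re z = 0 \<longrightarrow> \<not> is_eigenvalue (N_mat P \<alpha> \<beta> \<epsilon>) z"
    and \<xi>d: "\<xi>d = (\<lambda>t. vjoin (qd t) (vjoin (pd t) (xed t)))"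
      "\<forall>t\<ge>0. (\<xi>d has_vector_derivative P *v grad (\<lambda>\<xi>. Hd Md Me Vd \<xi> t) (\<xi>d t)) (at t within {0..})"
  shows "contraction_converges (closed_loop M V G J Md Me Vd S1 S2 Fe) D \<xi>d"
proof -
  define H where "H t = grad (\<lambda>\<xi>. Hd Md Me Vd \<xi> t)" for t
  have V1: "V differentiable (at q)" for q
    using V(2) unfolding C2_timed_def by blast
  have Vd1: "(\<lambda>z. Vd (vfst z) (vsnd z) t) differentiable (at z)"
    and Vd2: "grad (\<lambda>z. Vd (vfst z) (vsnd z) t) differentiable (at z)" if "t \<ge> 0" for t z
    using Vd(2) that unfolding C2_timed_def by blast+
  have cl: "closed_loop M V G J Md Me Vd S1 S2 Fe x t = P *v H t x" if t: "t \<ge> 0" for x t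
    unfolding P H_def
  proof (rule closed_loop_eq_grad[where Vd = Vd and t = t and V = V and Gperp = Gperp, OF Md Me Vd1[OF t] Vd2[OF t] dims M V1])
    show "rank (G q) = CARD('m)" "left_annihilator (Gperp q) (G q)" for q using G(2) Gperp by auto
    show "S1 = hcat s11 s12" by (rule S1(1))
  qed (use matching1 matching2 t in auto)
  obtain X \<eta> where X: "transpose X = X" "\<And>x. x \<noteq> 0 \<Longrightarrow> x \<bullet> (X *v x) > 0" "\<eta> > 0"
    and lmi: "\<And>S x. transpose S = S \<Longrightarrow> (\<And>z. \<alpha> * (norm z)\<^sup>2 \<le> z \<bullet> (S *v z)) \<Longrightarrow>
      (\<And>z. z \<bullet> (S *v z) \<le> \<beta> * (norm z)\<^sup>2) \<Longrightarrow> x \<bullet> (X *v (P *v (S *v x))) \<le> - \<eta> * (norm x)\<^sup>2"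
    using contraction_lmi[OF hurwitz bounds(1,2) N(1)] N(2) by blast
  have deriv: "((\<lambda>x. closed_loop M V G J Md Me Vd S1 S2 Fe x t) has_derivative
      (\<lambda>h. P *v (hess (\<lambda>\<xi>. Hd Md Me Vd \<xi> t) x *v h))) (at x)" if t: "t \<ge> 0" for x t
  proof -
    have "H t differentiable (at x)"
      unfolding H_def by (rule differentiable_grad_Hd[where Vd = Vd and t = t, OF Md Me Vd1[OF t] Vd2[OF t]])
    then have "(H t has_derivative (\<lambda>h. hess (\<lambda>\<xi>. Hd Md Me Vd \<xi> t) x *v h)) (at x)"
      by (simp add: jacobian_works hess_def H_def)
    then show ?thesis unfolding cl[OF t] by (rule has_derivative_mv)
  qed
  show ?thesis
  proof (rule contraction_converges_const_metric[OF X])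
    fix x t assume xt: "x \<in> D" "t \<ge> (0::real)"
    show diff: "(\<lambda>x. closed_loop M V G J Md Me Vd S1 S2 Fe x t) differentiable (at x)"
      using deriv[OF xt(2)] by (auto simp: differentiable_def)
    fix h
    let ?S = "hess (\<lambda>\<xi>. Hd Md Me Vd \<xi> t) x"
    \<comment> \<open>Uniqueness of the derivative identifies the Jacobian with \<open>P\<close>
      times the Hessian, the shape that \<open>lmi\<close> treats.\<close>
    have "jacobian (\<lambda>x. closed_loop M V G J Md Me Vd S1 S2 Fe x t) (at x) *v h = P *v (?S *v h)"
      using has_derivative_unique[OF diff[unfolded jacobian_works] deriv[OF xt(2)]] by (rule fun_cong)
    moreover have pd: "posdef (?S - mat \<alpha>)" "posdef (mat \<beta> - ?S)" using bounds(4) xt by auto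
    ultimately show "h \<bullet> (X *v (jacobian (\<lambda>x. closed_loop M V G J Md Me Vd S1 S2 Fe x t) (at x) *v h))
        \<le> - \<eta> * (norm h)\<^sup>2"
      using lmi[OF posdef_diff_mat(3)[OF pd(1)] posdef_diff_mat(1)[OF pd(1)] posdef_diff_mat(2)[OF pd(2)], of h]
      by simp
  next
    show "trajectory_on {0..} (closed_loop M V G J Md Me Vd S1 S2 Fe) \<xi>d"
      using \<xi>d(2) by (simp add: trajectory_on_def cl H_def)
  qed
qed

end
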